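(* Let $X$ be a compact complex manifold and $D\subseteq X$ a divisor with simple normal crossings, with smooth irreducible components $D_1,\dots,D_m$. For each $k$ let $s_k$ be a global section of $\mathcal{O}(D_k)$ with $\operatorname{div}s_k=D_k$ and $\|\cdot\|_k$ a smooth hermitian metric on $\mathcal{O}(D_k)$ with $\|s_k\|_k^2\leq e^{-e}$, and put $\Theta_N=\sum_{k=1}^m(\log\log\|s_k\|_k^{-2})^N$ on $X\setminus D$. Let $\omega$ be a smooth positive $(1,1)$-form on $X$ and $\eta$ a real $(1,1)$-form on $X\setminus D$ of log-log growth along $D$. Then there exist constants $A,B>0$ and an integer $N\geq0$ such that on $X\setminus D$ $$\eta+B\Theta_N\big(dd^c(-\Theta_1)+A\omega\big)\geq0.$$ If moreover $\eta$ has Poincaré growth along $D$, then $N$ can be chosen to be $0$.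
   Context: $d^c=(4\pi i)^{-1}(\partial-\bar\partial)$, so $dd^c=\frac{i}{2\pi}\partial\bar\partial$. An analytic chart $(V;z_1,\dots,z_n)$ is adapted to $D$ if $|z_i|<1/e$ and $D\cap V=\{z_1\cdots z_m=0\}$. Put $d\zeta_k=dz_k/(z_k\log|z_k|^{-1})$ for $k\le m$ and $d\zeta_k=dz_k$ for $k>m$. A form on $X\setminus D$ has log-log growth along $D$ if in every adapted chart it is a sum of products of the $d\zeta_k,d\bar\zeta_k$ with smooth coefficients $g$ such that on each $V'\Subset V$, $|g|\leq C\prod_{k=1}^m(\log\log|z_k|^{-1})^N$ for some $C,N$; it has Poincaré growth if the coefficients are locally bounded on $V$. *)

theory Defs
  imports "HOL-Analysis.Analysis"
begin

section \<open>Smooth and holomorphic functions on open subsets of Euclidean space\<close>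

primrec Ck_on :: "nat \<Rightarrow> 'a::euclidean_space set \<Rightarrow> ('a \<Rightarrow> 'b::real_normed_vector) \<Rightarrow> bool" where
  "Ck_on 0 S f \<longleftrightarrow> continuous_on S f"
| "Ck_on (Suc k) S f \<longleftrightarrow>
     (\<forall>x\<in>S. f differentiable (at x)) \<and> (\<forall>v. Ck_on k S (\<lambda>x. frechet_derivative f (at x) v))"

definition Cinf_on :: "'a::euclidean_space set \<Rightarrow> ('a \<Rightarrow> 'b::real_normed_vector) \<Rightarrow> bool" where
  "Cinf_on S f \<longleftrightarrow> (\<forall>k. Ck_on k S f)"

definition holo_on :: "(complex^'n) set \<Rightarrow> (complex^'n \<Rightarrow> complex) \<Rightarrow> bool" where
  "holo_on S f \<longleftrightarrow>
     (\<forall>x\<in>S. \<exists>f'. (f has_derivative f') (at x) \<and> (\<forall>c u. f' (c *s u) = c * f' u))"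

section \<open>Complex manifolds\<close>

text \<open>The manifold is a whole Hausdorff type. A chart is a pair of an open set \<open>V\<close> and a
  coordinate map \<open>z\<close>; the values of \<open>z\<close> outside \<open>V\<close> are irrelevant.\<close>

type_synonym ('x, 'n) chart = "'x set \<times> ('x \<Rightarrow> complex^'n)"

definition is_chart :: "('x::t2_space, 'n::finite) chart \<Rightarrow> bool" where
  "is_chart = (\<lambda>(V, z). open V \<and> open (z ` V) \<and> homeomorphism V (z ` V) z (inv_into V z))"

definition transition :: "('x, 'n) chart \<Rightarrow> ('x, 'n) chart \<Rightarrow> complex^'n \<Rightarrow> complex^'n" where
  "transition = (\<lambda>(V, z) (W, w). w \<circ> inv_into V z)"

definition holo_compatible :: "('x, 'n::finite) chart \<Rightarrow> ('x, 'n) chart \<Rightarrow> bool" where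
  "holo_compatible c d \<longleftrightarrow>
     (\<forall>i. holo_on (snd c ` (fst c \<inter> fst d)) (\<lambda>x. transition c d x $ i)) \<and>
     (\<forall>i. holo_on (snd d ` (fst c \<inter> fst d)) (\<lambda>x. transition d c x $ i))"

text \<open>A complex structure of dimension \<open>CARD('n)\<close>, given by its maximal holomorphic atlas; the
  analytic charts of the manifold are the elements of the atlas.\<close>

definition complex_structure :: "('x::t2_space, 'n::finite) chart set \<Rightarrow> bool" where
  "complex_structure atl \<longleftrightarrow>
     (\<forall>c\<in>atl. is_chart c) \<and>
     (\<Union>c\<in>atl. fst c) = UNIV \<and>
     (\<forall>c\<in>atl. \<forall>d\<in>atl. holo_compatible c d) \<and>
     (\<forall>c. is_chart c \<and> (\<forall>d\<in>atl. holo_compatible c d) \<longrightarrow> c \<in> atl)"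

definition smooth_fun ::
  "('x, 'n::finite) chart set \<Rightarrow> 'x set \<Rightarrow> ('x \<Rightarrow> 'b::real_normed_vector) \<Rightarrow> bool" where
  "smooth_fun atl U f \<longleftrightarrow> (\<forall>(V, z)\<in>atl. Cinf_on (z ` (V \<inter> U)) (f \<circ> inv_into V z))"

definition holo_fun :: "('x, 'n::finite) chart set \<Rightarrow> 'x set \<Rightarrow> ('x \<Rightarrow> complex) \<Rightarrow> bool" where
  "holo_fun atl U f \<longleftrightarrow> (\<forall>(V, z)\<in>atl. holo_on (z ` (V \<inter> U)) (f \<circ> inv_into V z))"

section \<open>Differential forms\<close>

subsection \<open>Forms on open subsets of \<open>\<complex>\<^sup>n\<close>\<close>

text \<open>Covectors are \<open>\<real>\<close>-linear maps from \<open>\<complex>\<^sup>n\<close> to \<open>\<complex>\<close>, and 2-covectors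
  are alternating \<open>\<real>\<close>-bilinear maps. The wedge product and the exterior derivative of
  1-forms are normalised without a factor 1/2.\<close>

definition wedge ::
  "(complex^'n \<Rightarrow> complex) \<Rightarrow> (complex^'n \<Rightarrow> complex) \<Rightarrow> complex^'n \<Rightarrow> complex^'n \<Rightarrow> complex" where
  "wedge \<alpha> \<beta> u v = \<alpha> u * \<beta> v - \<alpha> v * \<beta> u"

definition ext_d ::
  "(complex^'n \<Rightarrow> complex^'n \<Rightarrow> complex) \<Rightarrow> complex^'n::finite \<Rightarrow> complex^'n \<Rightarrow> complex^'n \<Rightarrow> complex" where
  "ext_d \<alpha> a u v =
     frechet_derivative (\<lambda>x. \<alpha> x v) (at a) u - frechet_derivative (\<lambda>x. \<alpha> x u) (at a) v"

text \<open>The \<open>\<complex>\<close>-linear and the \<open>\<complex>\<close>-antilinear part of the differential.\<close>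

definition del :: "(complex^'n::finite \<Rightarrow> complex) \<Rightarrow> complex^'n \<Rightarrow> complex^'n \<Rightarrow> complex" where
  "del f a u =
     (frechet_derivative f (at a) u - \<i> * frechet_derivative f (at a) (\<i> *s u)) / 2"

definition delbar :: "(complex^'n::finite \<Rightarrow> complex) \<Rightarrow> complex^'n \<Rightarrow> complex^'n \<Rightarrow> complex" where
  "delbar f a u =
     (frechet_derivative f (at a) u + \<i> * frechet_derivative f (at a) (\<i> *s u)) / 2"

definition d_c :: "(complex^'n::finite \<Rightarrow> complex) \<Rightarrow> complex^'n \<Rightarrow> complex^'n \<Rightarrow> complex" where
  "d_c f a u = (del f a u - delbar f a u) / (4 * of_real pi * \<i>)"

subsection \<open>Forms on a complex manifold\<close>

text \<open>A 2-form is given by its local expressions: \<open>\<eta> (V, z) p u v\<close> is the value at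
  \<open>p\<close> of \<open>\<eta>\<close> on the tangent vectors that the chart \<open>(V, z)\<close> identifies with
  \<open>u\<close> and \<open>v\<close>. The local expressions transform under changes of charts by pullback.\<close>

type_synonym ('x, 'n) form2 =
  "('x, 'n) chart \<Rightarrow> 'x \<Rightarrow> complex^'n \<Rightarrow> complex^'n \<Rightarrow> complex"

definition two_form :: "('x, 'n::finite) chart set \<Rightarrow> 'x set \<Rightarrow> ('x, 'n) form2 \<Rightarrow> bool" where
  "two_form atl U \<eta> \<longleftrightarrow>
     (\<forall>c\<in>atl. \<forall>p\<in>fst c \<inter> U. bilinear (\<eta> c p) \<and> (\<forall>u. \<eta> c p u u = 0)) \<and>
     (\<forall>c\<in>atl. \<forall>d\<in>atl. \<forall>p\<in>fst c \<inter> fst d \<inter> U. \<forall>u v.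
        \<eta> c p u v =
          (let J = frechet_derivative (transition c d) (at (snd c p)) in \<eta> d p (J u) (J v)))"

text \<open>Multiplication of both arguments by \<open>\<i>\<close> acts as 1 on the (1,1)-part of a
  complex-valued 2-covector and as -1 on its (2,0)- and (0,2)-parts.\<close>

definition real_11_form :: "('x, 'n::finite) chart set \<Rightarrow> 'x set \<Rightarrow> ('x, 'n) form2 \<Rightarrow> bool" where
  "real_11_form atl U \<eta> \<longleftrightarrow> two_form atl U \<eta> \<and>
     (\<forall>c\<in>atl. \<forall>p\<in>fst c \<inter> U. \<forall>u v.
        \<eta> c p (\<i> *s u) (\<i> *s v) = \<eta> c p u v \<and> \<eta> c p u v \<in> \<real>)"

definition smooth_form :: "('x, 'n::finite) chart set \<Rightarrow> 'x set \<Rightarrow> ('x, 'n) form2 \<Rightarrow> bool" where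
  "smooth_form atl U \<eta> \<longleftrightarrow>
     (\<forall>(V, z)\<in>atl. \<forall>u v. Cinf_on (z ` (V \<inter> U)) (\<lambda>x. \<eta> (V, z) (inv_into V z x) u v))"

text \<open>The form \<open>\<i> \<Sum> h\<^sub>j\<^sub>k dz\<^sub>j \<and> cnj dz\<^sub>k\<close> takes the value
  \<open>2 \<Sum> h\<^sub>j\<^sub>k u\<^sub>j cnj u\<^sub>k\<close> on \<open>(u, \<i>u)\<close>.\<close>

definition nonneg_form :: "('x, 'n::finite) chart set \<Rightarrow> 'x set \<Rightarrow> ('x, 'n) form2 \<Rightarrow> bool" where
  "nonneg_form atl U \<eta> \<longleftrightarrow>
     (\<forall>c\<in>atl. \<forall>p\<in>fst c \<inter> U. \<forall>u. \<eta> c p u (\<i> *s u) \<in> \<real> \<and> Re (\<eta> c p u (\<i> *s u)) \<ge> 0)"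

definition pos_form :: "('x, 'n::finite) chart set \<Rightarrow> 'x set \<Rightarrow> ('x, 'n) form2 \<Rightarrow> bool" where
  "pos_form atl U \<eta> \<longleftrightarrow>
     (\<forall>c\<in>atl. \<forall>p\<in>fst c \<inter> U. \<forall>u. u \<noteq> 0 \<longrightarrow>
        \<eta> c p u (\<i> *s u) \<in> \<real> \<and> Re (\<eta> c p u (\<i> *s u)) > 0)"

definition ddc :: "('x \<Rightarrow> real) \<Rightarrow> ('x, 'n::finite) form2" where
  "ddc f = (\<lambda>(V, z) p. ext_d (d_c (\<lambda>x. complex_of_real (f (inv_into V z x)))) (z p))"

section \<open>Simple normal crossings divisors\<close>

text \<open>Near each point, the components through it are distinct coordinate hyperplanes of one
  chart; in particular each component is a closed complex submanifold of codimension 1, and as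
  such it is irreducible iff it is connected.\<close>

definition snc_divisor ::
  "('x::t2_space, 'n::finite) chart set \<Rightarrow> nat \<Rightarrow> (nat \<Rightarrow> 'x set) \<Rightarrow> bool" where
  "snc_divisor atl m D \<longleftrightarrow>
     (\<forall>k\<in>{1..m}. D k \<noteq> {} \<and> connected (D k)) \<and>
     (\<forall>p. \<exists>(V, z)\<in>atl. p \<in> V \<and>
        (\<exists>j. inj_on j {k\<in>{1..m}. p \<in> D k} \<and>
             (\<forall>k\<in>{1..m}. D k \<inter> V = (if p \<in> D k then {q\<in>V. z q $ j k = 0} else {}))))"

section \<open>The line bundle of a smooth hypersurface\<close>

text \<open>Local equations of the smooth hypersurface \<open>D\<close>: holomorphic functions \<open>f\<close> on open
  sets \<open>U\<close> that vanish exactly on \<open>D \<inter> U\<close>, to order 1 at each point of it, i.e. with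
  divisor \<open>D \<inter> U\<close>.\<close>

definition local_equations ::
  "('x::t2_space, 'n::finite) chart set \<Rightarrow> 'x set \<Rightarrow> ('x set \<times> ('x \<Rightarrow> complex)) set" where
  "local_equations atl D = {(U, f). open U \<and> holo_fun atl U f \<and>
     (\<forall>p\<in>U. f p = 0 \<longleftrightarrow> p \<in> D) \<and>
     (\<forall>(V, z)\<in>atl. \<forall>p\<in>V \<inter> U \<inter> D. \<exists>u. frechet_derivative (f \<circ> inv_into V z) (at (z p)) u \<noteq> 0)}"

text \<open>\<open>\<O>(D)\<close> is the line bundle with a trivialisation over \<open>U\<close> for each local equation
  \<open>(U, f)\<close> and with the transition functions \<open>f / g\<close> from \<open>(W, g)\<close> to \<open>(U, f)\<close>,
  extended holomorphically across \<open>D\<close>. A section \<open>\<sigma>\<close> is given by its expressions in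
  these trivialisations, which satisfy \<open>\<sigma>\<^sub>f = (f / g) \<sigma>\<^sub>g\<close> on \<open>U \<inter> W\<close>. The law below
  says this off \<open>D\<close>, and on \<open>D\<close>, which is nowhere dense, it then holds by continuity.\<close>

definition global_section ::
  "('x::t2_space, 'n::finite) chart set \<Rightarrow> 'x set \<Rightarrow> ('x set \<times> ('x \<Rightarrow> complex) \<Rightarrow> 'x \<Rightarrow> complex) \<Rightarrow> bool"
  where
  "global_section atl D \<sigma> \<longleftrightarrow>
     (\<forall>(U, f)\<in>local_equations atl D. holo_fun atl U (\<sigma> (U, f))) \<and>
     (\<forall>(U, f)\<in>local_equations atl D. \<forall>(W, g)\<in>local_equations atl D. \<forall>p\<in>U \<inter> W.
        \<sigma> (U, f) p * g p = \<sigma> (W, g) p * f p)"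

text \<open>The equality \<open>div \<sigma> = D\<close>, for a section \<open>\<sigma>\<close> of \<open>\<O>(D)\<close>.\<close>

definition div_eq ::
  "('x::t2_space, 'n::finite) chart set \<Rightarrow> 'x set \<Rightarrow> ('x set \<times> ('x \<Rightarrow> complex) \<Rightarrow> 'x \<Rightarrow> complex) \<Rightarrow> bool"
  where
  "div_eq atl D \<sigma> \<longleftrightarrow>
     (\<forall>(U, f)\<in>local_equations atl D. (U, \<sigma> (U, f)) \<in> local_equations atl D)"

text \<open>A hermitian metric on \<open>\<O>(D)\<close> is given by its local weights \<open>h\<close>, with
  \<open>\<parallel>\<sigma>\<parallel>\<^sup>2 = h\<^sub>f |\<sigma>\<^sub>f|\<^sup>2\<close> on \<open>U\<close>; the transition law is
  \<open>h\<^sub>f |f / g|\<^sup>2 = h\<^sub>g\<close>, stated as for sections.\<close>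

definition hermitian_metric ::
  "('x::t2_space, 'n::finite) chart set \<Rightarrow> 'x set \<Rightarrow> ('x set \<times> ('x \<Rightarrow> complex) \<Rightarrow> 'x \<Rightarrow> real) \<Rightarrow> bool"
  where
  "hermitian_metric atl D h \<longleftrightarrow>
     (\<forall>(U, f)\<in>local_equations atl D. smooth_fun atl U (h (U, f)) \<and> (\<forall>p\<in>U. h (U, f) p > 0)) \<and>
     (\<forall>(U, f)\<in>local_equations atl D. \<forall>(W, g)\<in>local_equations atl D. \<forall>p\<in>U \<inter> W.
        h (U, f) p * (cmod (f p))\<^sup>2 = h (W, g) p * (cmod (g p))\<^sup>2)"

text \<open>The function \<open>\<parallel>\<sigma>\<parallel>\<^sup>2\<close>; by the transition laws the choice is immaterial.\<close>

definition norm_sq ::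
  "('x::t2_space, 'n::finite) chart set \<Rightarrow> 'x set \<Rightarrow> ('x set \<times> ('x \<Rightarrow> complex) \<Rightarrow> 'x \<Rightarrow> real) \<Rightarrow>
     ('x set \<times> ('x \<Rightarrow> complex) \<Rightarrow> 'x \<Rightarrow> complex) \<Rightarrow> 'x \<Rightarrow> real" where
  "norm_sq atl D h \<sigma> p =
     (let e = (SOME e. e \<in> local_equations atl D \<and> p \<in> fst e) in h e p * (cmod (\<sigma> e p))\<^sup>2)"

definition Theta :: "nat \<Rightarrow> (nat \<Rightarrow> 'x \<Rightarrow> real) \<Rightarrow> nat \<Rightarrow> 'x \<Rightarrow> real" where
  "Theta m nsq N p = (\<Sum>k=1..m. (ln (ln (inverse (nsq k p)))) ^ N)"

section \<open>Growth conditions\<close>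

text \<open>As the index type of the coordinates carries no order, a set \<open>S\<close> of indices takes the
  place of the first \<open>m\<close> of them.\<close>

definition adapted_chart ::
  "('x, 'n::finite) chart set \<Rightarrow> 'x set \<Rightarrow> ('x, 'n) chart \<Rightarrow> 'n set \<Rightarrow> bool" where
  "adapted_chart atl D = (\<lambda>(V, z) S. (V, z) \<in> atl \<and>
     (\<forall>p\<in>V. \<forall>i. cmod (z p $ i) < 1 / exp 1) \<and>
     D \<inter> V = {p\<in>V. (\<Prod>k\<in>S. z p $ k) = 0})"

text \<open>The covectors \<open>d\<zeta>\<^sub>k\<close> (index \<open>Inl k\<close>) and their conjugates (index \<open>Inr k\<close>) at a
  point with coordinates \<open>a\<close>.\<close>

definition dzeta :: "'n set \<Rightarrow> complex^'n \<Rightarrow> 'n \<Rightarrow> complex^'n \<Rightarrow> complex" where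
  "dzeta S a k u =
     (if k \<in> S then u $ k / (a $ k * of_real (ln (inverse (cmod (a $ k))))) else u $ k)"

definition coframe :: "'n set \<Rightarrow> complex^'n \<Rightarrow> 'n + 'n \<Rightarrow> complex^'n \<Rightarrow> complex" where
  "coframe S a b u = (case b of Inl k \<Rightarrow> dzeta S a k u | Inr k \<Rightarrow> cnj (dzeta S a k u))"

text \<open>\<open>g\<close> is a family of smooth coefficients of \<open>\<eta>\<close> on \<open>V - D\<close> with respect to the
  products of the \<open>d\<zeta>\<^sub>k\<close> and their conjugates.\<close>

definition coefficients ::
  "('x, 'n::finite) chart set \<Rightarrow> 'x set \<Rightarrow> ('x, 'n) form2 \<Rightarrow> ('x, 'n) chart \<Rightarrow> 'n set \<Rightarrow>
     ('n + 'n \<Rightarrow> 'n + 'n \<Rightarrow> 'x \<Rightarrow> complex) \<Rightarrow> bool" where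
  "coefficients atl D \<eta> = (\<lambda>(V, z) S g.
     (\<forall>a b. smooth_fun atl (V - D) (g a b)) \<and>
     (\<forall>p\<in>V - D. \<forall>u v.
        \<eta> (V, z) p u v =
          (\<Sum>a\<in>UNIV. \<Sum>b\<in>UNIV. g a b p * wedge (coframe S (z p) a) (coframe S (z p) b) u v)))"

definition loglog_growth ::
  "('x::t2_space, 'n::finite) chart set \<Rightarrow> 'x set \<Rightarrow> ('x, 'n) form2 \<Rightarrow> bool" where
  "loglog_growth atl D \<eta> \<longleftrightarrow>
     (\<forall>V z S. adapted_chart atl D (V, z) S \<longrightarrow>
       (\<exists>g. coefficients atl D \<eta> (V, z) S g \<and>
         (\<forall>a b. \<forall>V'. compact (closure V') \<and> closure V' \<subseteq> V \<longrightarrow>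
           (\<exists>(C::real) (N::nat). \<forall>p\<in>V' - D.
              cmod (g a b p) \<le> C * (\<Prod>k\<in>S. (ln (ln (inverse (cmod (z p $ k))))) ^ N)))))"

definition poincare_growth ::
  "('x::t2_space, 'n::finite) chart set \<Rightarrow> 'x set \<Rightarrow> ('x, 'n) form2 \<Rightarrow> bool" where
  "poincare_growth atl D \<eta> \<longleftrightarrow>
     (\<forall>V z S. adapted_chart atl D (V, z) S \<longrightarrow>
       (\<exists>g. coefficients atl D \<eta> (V, z) S g \<and>
         (\<forall>a b. \<forall>p\<in>V. \<exists>W. open W \<and> p \<in> W \<and>
           (\<exists>C::real. \<forall>q\<in>(W \<inter> V) - D. cmod (g a b q) \<le> C))))"

end

theory Submission
  imports Defs "HOL-Complex_Analysis.Cauchy_Integral_Formula"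
begin

text \<open>Let \<open>z\<^sub>j = 0\<close> be the equation of \<open>D\<^sub>k\<close> in an adapted chart. Then
  \<open>L = - ln \<parallel>s\<^sub>k\<parallel>\<^sup>2\<close> is a smooth function minus \<open>ln |z\<^sub>j|\<^sup>2\<close>, and
  \<open>dd\<^sup>c (- ln L) = - dd\<^sup>c L / L + dL \<and> d\<^sup>c L / L\<^sup>2\<close>. Since \<open>ln |z\<^sub>j|\<^sup>2\<close> is pluriharmonic, the
  first term is bounded, whereas the second one dominates a multiple of \<open>|d\<zeta>\<^sub>j|\<^sup>2\<close> up to a
  bounded error, as \<open>L\<close> is comparable to \<open>ln |z\<^sub>j|\<^sup>-\<^sup>1\<close>. Adding a large multiple of \<open>\<omega>\<close>
  absorbs the bounded terms and gives a form dominating a multiple of \<open>\<Sum> |d\<zeta>\<^sub>k|\<^sup>2\<close>. The coefficients of \<open>\<eta>\<close>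
  are bounded by a multiple of \<open>\<Theta>\<^sub>N\<close>, because \<open>ln ln |z\<^sub>j|\<^sup>-\<^sup>1\<close> is bounded by a multiple of \<open>ln L\<close>;
  so \<open>\<eta>\<close> is absorbed as well. By compactness the local constants can be chosen uniformly.

  All (1,1)-forms are tested on pairs \<open>(u, \<i>u)\<close>, where \<open>dd\<^sup>c f\<close> is
  \<open>(f''(u, u) + f''(\<i>u, \<i>u)) / 4\<pi>\<close>.\<close>

section \<open>Derivatives of holomorphic functions\<close>

text \<open>\<open>ddc\<close> is computed anew in every chart and \<open>nonneg_form\<close>
  quantifies over the whole maximal atlas, so an estimate in one adapted chart becomes useful only
  once \<open>ddc\<close> is known to transform by pullback. This takes two derivatives of the
  transition maps, while \<open>holo_on\<close> grants one; Cauchy's formula on complex lines yields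
  the second. In the chain rule the extra term contains the second derivative of the transition,
  which changes sign when u is replaced by iu, so it cancels on the pair. The other obstacle is
  uniformity: the exponents bounding the coefficients of \<open>\<eta>\<close> depend on the chart
  and on the coefficient. Compactness is therefore applied to a statement stable under enlarging all
  constants, "for all A, B, N >= n", with a single natural number n. Enlarging B or N does no harm:
  for large A the form multiplied by them is already nonnegative, and Theta_N grows with N because
  the bound exp(-e) on the norms makes every ln ln at least 1. In the Poincare case the same charts
  and constants serve with N = 0, where Theta_0 is the constant m.\<close>

lemma norm_vector_smult: "norm (c *s (v::complex^'n::finite)) = cmod c * norm v"
  by (simp add: norm_vec_def norm_mult L2_set_right_distrib)

lemma bounded_linear_smult_left: "bounded_linear (\<lambda>c. c *s (v::complex^'n::finite))"
  by (rule bounded_linear_intro[where K = "norm v"])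
     (simp_all add: norm_vector_smult vec_eq_iff algebra_simps)

lemma bounded_linear_smult_right: "bounded_linear (\<lambda>v::complex^'n::finite. c *s v)"
  by (rule bounded_linear_intro[where K = "cmod c"])
     (simp_all add: norm_vector_smult vec_eq_iff algebra_simps)

lemma holo_on_has_derivative:
  assumes "holo_on S f" "x \<in> S"
  shows "(f has_derivative frechet_derivative f (at x)) (at x)"
    and "frechet_derivative f (at x) (c *s u) = c * frechet_derivative f (at x) u"
proof -
  obtain f' where f': "(f has_derivative f') (at x)" "\<forall>c u. f' (c *s u) = c * f' u"
    using assms unfolding holo_on_def by blast
  have "frechet_derivative f (at x) = f'"
    using f'(1) by (metis frechet_derivative_at)
  with f' show "(f has_derivative frechet_derivative f (at x)) (at x)"
    "frechet_derivative f (at x) (c *s u) = c * frechet_derivative f (at x) u" by auto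
qed

lemma holo_on_subset: "holo_on S f \<Longrightarrow> T \<subseteq> S \<Longrightarrow> holo_on T f"
  unfolding holo_on_def by blast

lemma holo_on_continuous: "holo_on S f \<Longrightarrow> continuous_on S f"
  by (meson continuous_at_imp_continuous_on has_derivative_continuous holo_on_has_derivative(1))

text \<open>Cauchy's formula for g' at 0, where g is f restricted to the complex line through x in
  direction w. The derivative of the circle path is 2 pi i times the path itself, which cancels one
  of the two powers in the denominator.\<close>

lemma holo_on_derivative_integral:
  fixes f :: "complex^'n::finite \<Rightarrow> complex"
  assumes hol: "holo_on S f" and r: "r > 0"
    and disc: "\<And>\<zeta>. cmod \<zeta> \<le> r \<Longrightarrow> x + \<zeta> *s w \<in> S"
  shows "frechet_derivative f (at x) w =
    integral {0..1} (\<lambda>t. f (x + circlepath 0 r t *s w) / circlepath 0 r t)"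
proof -
  define g where "g = (\<lambda>\<zeta>. f (x + \<zeta> *s w))"
  have dg: "(g has_field_derivative frechet_derivative f (at (x + \<zeta> *s w)) w) (at \<zeta>)"
    if "cmod \<zeta> \<le> r" for \<zeta>
  proof -
    let ?f' = "frechet_derivative f (at (x + \<zeta> *s w))"
    have 1: "((\<lambda>\<zeta>. x + \<zeta> *s w) has_derivative (\<lambda>c. c *s w)) (at \<zeta>)"
      by (auto intro!: derivative_eq_intros bounded_linear_imp_has_derivative bounded_linear_smult_left)
    have 2: "(f has_derivative ?f') (at (x + \<zeta> *s w))"
      using holo_on_has_derivative(1)[OF hol disc[OF that]] .
    have "(f \<circ> (\<lambda>\<zeta>. x + \<zeta> *s w) has_derivative ?f' \<circ> (\<lambda>c. c *s w)) (at \<zeta>)"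
      by (rule diff_chain_at[OF 1 2])
    moreover have "?f' \<circ> (\<lambda>c. c *s w) = (*) (?f' w)"
      using holo_on_has_derivative(2)[OF hol disc[OF that]] by (auto simp: fun_eq_iff mult.commute)
    ultimately show ?thesis
      unfolding g_def has_field_derivative_def comp_def by simp
  qed
  have cont: "continuous_on (cball 0 r) g"
    by (rule continuous_at_imp_continuous_on) (auto intro: DERIV_isCont[OF dg])
  have holg: "g holomorphic_on ball 0 r"
    unfolding holomorphic_on_open[OF open_ball]
  proof
    fix \<zeta> :: complex assume "\<zeta> \<in> ball 0 r"
    then have "cmod \<zeta> \<le> r" by simp
    from dg[OF this] show "\<exists>f'. (g has_field_derivative f') (at \<zeta>)" by blast
  qed
  have dg0: "deriv g 0 = frechet_derivative f (at x) w"
    using dg[of 0] r by (simp add: DERIV_imp_deriv)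
  have "2 * of_real pi * \<i> * frechet_derivative f (at x) w =
     contour_integral (circlepath 0 r) (\<lambda>u. g u / u^2)"
    using Cauchy_contour_integral_circlepath_2[OF cont holg, of 0] r by (simp add: dg0)
  also have "\<dots> = integral {0..1} (\<lambda>t. 2 * of_real pi * \<i> * (f (x + circlepath 0 r t *s w) / circlepath 0 r t))"
    unfolding contour_integral_integral vector_derivative_circlepath
    using r by (intro integral_cong) (simp add: g_def circlepath field_simps power2_eq_square)
  also have "\<dots> = 2 * of_real pi * \<i> * integral {0..1} (\<lambda>t. f (x + circlepath 0 r t *s w) / circlepath 0 r t)"
    by (rule integral_mult_right)
  finally show ?thesis by simp
qed

lemma circlepath_disc_in:
  fixes x w :: "complex^'n::finite"
  assumes "x \<in> ball x0 d" "cball x0 (2*d) \<subseteq> S" "r * norm w \<le> d" "cmod \<zeta> \<le> r"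
  shows "x + \<zeta> *s w \<in> S"
proof -
  have "norm (\<zeta> *s w) \<le> d"
    using assms(3) mult_right_mono[OF assms(4) norm_ge_zero[of w]] by (simp add: norm_vector_smult)
  moreover have "dist x0 x < d" using assms by simp
  moreover have "dist x0 (x + \<zeta> *s w) \<le> dist x0 x + norm (\<zeta> *s w)"
    using dist_triangle[of x0 "x + \<zeta> *s w" x] by (simp add: dist_norm)
  ultimately have "x + \<zeta> *s w \<in> cball x0 (2 * d)" by simp
  then show ?thesis using assms(2) by blast
qed

text \<open>The ball has radius 2d because d is reserved for moving the centre x away from x0 and d
  for the displacement along the circle; so one r serves all centres near x0. The denominator 1 +
  |w| covers w = 0.\<close>

lemma disc_radius:
  fixes w :: "complex^'n::finite"
  assumes "open S" "x0 \<in> S"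
  obtains d r where "d > 0" "r > 0" "cball x0 (2*d) \<subseteq> S" "r * norm w \<le> d"
proof -
  obtain e where e: "e > 0" "cball x0 e \<subseteq> S" using assms open_contains_cball by blast
  show thesis
  proof (rule that[of "e/2" "e/2 / (1 + norm w)"])
    show "e / 2 / (1 + norm w) * norm w \<le> e / 2"
      using e(1) by (simp add: field_simps add_pos_nonneg)
  qed (use e in \<open>auto simp: add_pos_nonneg\<close>)
qed

lemma continuous_circlepath: "continuous_on T (circlepath z r)"
  unfolding circlepath by (intro continuous_intros)

lemma circlepath_nz: "r > 0 \<Longrightarrow> circlepath 0 r t \<noteq> 0"
  by (simp add: circlepath)

lemma norm_circlepath: "r > 0 \<Longrightarrow> cmod (circlepath 0 r t) = r"
  by (simp add: circlepath norm_mult)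

lemma continuous_on_smult [continuous_intros]:
  fixes w :: "'a::topological_space \<Rightarrow> complex^'n::finite"
  assumes "continuous_on T c" "continuous_on T w"
  shows "continuous_on T (\<lambda>x. c x *s w x)"
  unfolding vector_scalar_mult_def using assms by (intro continuous_intros) auto

text \<open>The integral formula involves only values of f, and its radius is constant near x0, so
  continuity of f passes through the integral. This comes before differentiability because
  differentiating under the integral requires a continuous derivative of the integrand.\<close>

lemma holo_on_derivative_continuous:
  fixes f :: "complex^'n::finite \<Rightarrow> complex"
  assumes hol: "holo_on S f" and S: "open S"
  shows "continuous_on S (\<lambda>x. frechet_derivative f (at x) w)"
proof (rule continuous_at_imp_continuous_on, rule)
  fix x0 assume "x0 \<in> S"
  then obtain d r where d: "d > 0" "r > 0" "cball x0 (2*d) \<subseteq> S" "r * norm w \<le> d"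
    using disc_radius[OF S] by blast
  have inS: "x + circlepath 0 r t *s w \<in> S" if "x \<in> ball x0 d" for x t
    by (rule circlepath_disc_in[OF that d(3,4)]) (simp add: norm_circlepath d)
  have "continuous_on (ball x0 d \<times> cbox 0 1) (\<lambda>(x, t). f (x + circlepath 0 r t *s w) / circlepath 0 r t)"
    unfolding case_prod_beta
    by (intro continuous_intros continuous_on_compose2[OF holo_on_continuous[OF hol]]
          continuous_on_compose2[OF continuous_circlepath[of UNIV]])
       (use d inS in \<open>auto simp: circlepath_nz\<close>)
  then have "continuous_on (ball x0 d) (\<lambda>x. integral (cbox 0 1) (\<lambda>t. f (x + circlepath 0 r t *s w) / circlepath 0 r t))"
    by (rule integral_continuous_on_param)
  also have "?this \<longleftrightarrow> continuous_on (ball x0 d) (\<lambda>x. frechet_derivative f (at x) w)"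
  proof (rule continuous_on_cong[OF refl])
    fix x assume "x \<in> ball x0 d"
    from circlepath_disc_in[OF this d(3,4)] 
    show "integral (cbox 0 1) (\<lambda>t. f (x + circlepath 0 r t *s w) / circlepath 0 r t) = frechet_derivative f (at x) w"
      using holo_on_derivative_integral[OF hol d(2), of x w] by (simp add: cbox_interval)
  qed
  finally show "isCont (\<lambda>x. frechet_derivative f (at x) w) x0"
    using d(1) by (simp add: continuous_on_eq_continuous_at)
qed

text \<open>Cauchy's formula is differentiated in the centre x under the integral sign; the
  derivative of the integrand is complex linear, and integration over t preserves this.\<close>

lemma holo_on_derivative:
  fixes f :: "complex^'n::finite \<Rightarrow> complex"
  assumes hol: "holo_on S f" and S: "open S"
  shows "holo_on S (\<lambda>x. frechet_derivative f (at x) w)"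
  unfolding holo_on_def
proof
  fix x0 assume "x0 \<in> S"
  then obtain d r where d: "d > 0" "r > 0" "cball x0 (2*d) \<subseteq> S" "r * norm w \<le> d"
    using disc_radius[OF S] by blast
  have inS: "x + circlepath 0 r t *s w \<in> S" if "x \<in> ball x0 d" for x t
    by (rule circlepath_disc_in[OF that d(3,4)]) (simp add: norm_circlepath d)
  define c where "c = circlepath 0 r"
  have cnz: "c t \<noteq> 0" for t using d by (simp add: c_def circlepath_nz)
  have contc: "continuous_on T c" for T by (simp add: c_def continuous_circlepath)
  define f' where "f' = (\<lambda>x t u. frechet_derivative f (at (x + c t *s w)) u / c t)"
  \<comment> \<open>\<open>leibniz_rule\<close> expects derivatives packed as bounded linear
    functions; \<open>Blinfun\<close> is faithful only where \<open>bl\<close> applies, that is, for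
    centres in the ball.\<close>
  define fx where "fx = (\<lambda>x t. Blinfun (f' x t))"
  have bl: "bounded_linear (f' x t)" if "x \<in> ball x0 d" for x t
    unfolding f'_def c_def
    by (rule bounded_linear_compose[OF bounded_linear_divide
          has_derivative_bounded_linear[OF holo_on_has_derivative(1)[OF hol inS[OF that]]]])
  have fx: "blinfun_apply (fx x t) = f' x t" if "x \<in> ball x0 d" for x t
    unfolding fx_def by (rule bounded_linear_Blinfun_apply[OF bl[OF that]])
  have x0d: "x0 \<in> ball x0 d" using d(1) by simp
  have "((\<lambda>x. integral (cbox 0 1) (\<lambda>t. f (x + c t *s w) / c t)) has_derivative
      integral (cbox 0 1) (fx x0)) (at x0 within ball x0 d)"
  proof (rule leibniz_rule)
    fix x and t :: real assume x: "x \<in> ball x0 d"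
    have 1: "((\<lambda>x. x + c t *s w) has_derivative (\<lambda>u. u)) (at x within ball x0 d)"
      by (auto intro!: derivative_eq_intros)
    have 2: "(f has_derivative frechet_derivative f (at (x + c t *s w))) (at (x + c t *s w))"
      using holo_on_has_derivative(1)[OF hol] inS[OF x] by (auto simp: c_def)
    have "((\<lambda>x. f (x + c t *s w)) has_derivative frechet_derivative f (at (x + c t *s w))) (at x within ball x0 d)"
      using has_derivative_in_compose[OF 1, of f] has_derivative_at_withinI[OF 2] by blast
    then show "((\<lambda>x. f (x + c t *s w) / c t) has_derivative blinfun_apply (fx x t)) (at x within ball x0 d)"
      unfolding fx[OF x] f'_def
      by (rule bounded_linear.has_derivative[OF bounded_linear_divide])
  next
    fix x assume x: "x \<in> ball x0 d"
    show "(\<lambda>t. f (x + c t *s w) / c t) integrable_on cbox 0 1"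
      by (intro integrable_continuous continuous_intros contc continuous_on_compose2[OF holo_on_continuous[OF hol]])
         (use inS[OF x] cnz in \<open>auto simp: c_def\<close>)
  next
    \<comment> \<open>On a finite-dimensional space, continuity of an operator-valued map can be
      tested on single vectors, where the preceding lemma applies.\<close>
    show "continuous_on (ball x0 d \<times> cbox 0 1) (\<lambda>(x, t). fx x t)"
    proof (rule continuous_on_blinfun_componentwise)
      fix i :: "complex^'n"
      have "continuous_on (ball x0 d \<times> cbox 0 1) (\<lambda>(x,t). f' x t i)"
        unfolding case_prod_beta f'_def
        by (intro continuous_intros continuous_on_compose2[OF holo_on_derivative_continuous[OF hol S]]
          continuous_on_compose2[OF contc[of UNIV]])
           (use inS cnz in \<open>auto simp: c_def\<close>)
      then show "continuous_on (ball x0 d \<times> cbox 0 1) (\<lambda>p. blinfun_apply (case p of (x, t) \<Rightarrow> fx x t) i)"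
        by (rule continuous_on_eq) (auto simp: fx)
    qed
  qed (use x0d in auto)
  then have "((\<lambda>x. integral (cbox 0 1) (\<lambda>t. f (x + c t *s w) / c t)) has_derivative
      integral (cbox 0 1) (fx x0)) (at x0)"
    unfolding at_within_open[OF x0d open_ball] .
  then have der: "((\<lambda>x. frechet_derivative f (at x) w) has_derivative integral (cbox 0 1) (fx x0)) (at x0)"
  proof (rule has_derivative_transform_within_open[OF _ open_ball x0d])
    fix x assume "x \<in> ball x0 d"
    from circlepath_disc_in[OF this d(3,4)] 
    show "integral (cbox 0 1) (\<lambda>t. f (x + c t *s w) / c t) = frechet_derivative f (at x) w"
      using holo_on_derivative_integral[OF hol d(2), of x w] by (simp add: cbox_interval c_def)
  qed
  have cfx: "continuous_on (cbox 0 1) (fx x0)"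
  proof (rule continuous_on_blinfun_componentwise)
    fix i :: "complex^'n"
    have "continuous_on (cbox 0 1) (\<lambda>t. f' x0 t i)"
      unfolding f'_def
      by (intro continuous_intros continuous_on_compose2[OF holo_on_derivative_continuous[OF hol S]] contc)
         (use inS cnz d in \<open>auto simp: c_def\<close>)
    then show "continuous_on (cbox 0 1) (\<lambda>t. fx x0 t i)"
      using d by (simp add: fx)
  qed
  have app: "blinfun_apply (integral (cbox 0 1) (fx x0)) u = integral (cbox 0 1) (\<lambda>t. f' x0 t u)" for u
    using blinfun_apply_integral[OF integrable_continuous[OF cfx], of u] fx[of x0] d(1)
    by simp
  have "blinfun_apply (integral (cbox 0 1) (fx x0)) (a *s u) = a * blinfun_apply (integral (cbox 0 1) (fx x0)) u" for a u
  proof -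
    have "f' x0 t (a *s u) = a * f' x0 t u" for t
      unfolding f'_def using holo_on_has_derivative(2)[OF hol, of "x0 + c t *s w"] inS[of x0] d
      by (auto simp: c_def)
    then show ?thesis unfolding app by simp
  qed
  with der show "\<exists>f'. ((\<lambda>x. frechet_derivative f (at x) w) has_derivative f') (at x0) \<and> (\<forall>c u. f' (c *s u) = c * f' u)"
    by blast
qed

section \<open>Second derivatives\<close>

text \<open>First and second derivatives are carried as explicit data so that the rules below
  compute closed formulas for them. In \<open>H x v u\<close> the function is differentiated first
  along v, then along u.\<close>

definition hess_on ::
  "'a::real_normed_vector set \<Rightarrow> ('a \<Rightarrow> 'b::real_normed_vector) \<Rightarrow> ('a \<Rightarrow> 'a \<Rightarrow> 'b) \<Rightarrow>
     ('a \<Rightarrow> 'a \<Rightarrow> 'a \<Rightarrow> 'b) \<Rightarrow> bool" where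
  "hess_on S F G H \<longleftrightarrow> (\<forall>x\<in>S. (F has_derivative G x) (at x) \<and>
     (\<forall>v. ((\<lambda>y. G y v) has_derivative H x v) (at x)))"

lemma hess_onI:
  assumes "\<And>x. x \<in> S \<Longrightarrow> (F has_derivative G x) (at x)"
    and "\<And>x v. x \<in> S \<Longrightarrow> ((\<lambda>y. G y v) has_derivative H x v) (at x)"
  shows "hess_on S F G H"
  using assms unfolding hess_on_def by blast

lemma hess_onD:
  assumes "hess_on S F G H" "x \<in> S"
  shows "(F has_derivative G x) (at x)" "((\<lambda>y. G y v) has_derivative H x v) (at x)"
  using assms unfolding hess_on_def by blast+

lemma hess_on_subset: "hess_on S F G H \<Longrightarrow> T \<subseteq> S \<Longrightarrow> hess_on T F G H"
  unfolding hess_on_def by blast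

lemma hess_on_cong:
  assumes "hess_on S F G H" "open S" "\<And>x. x \<in> S \<Longrightarrow> F x = F' x"
  shows "hess_on S F' G H"
  using assms unfolding hess_on_def
  by (meson has_derivative_transform_within_open)

text \<open>Linearity in v is not built into \<open>hess_on\<close>: it is inherited from the
  linearity of \<open>G y\<close> at all y near x by uniqueness of derivatives, hence the open
  S.\<close>

lemma hess_on_linear:
  assumes "hess_on S F G H" "open S" "x \<in> S"
  shows "linear (G x)" "linear (H x v)" "linear (\<lambda>v. H x v u)"
proof -
  show 1: "linear (G x)" "linear (H x v)" for v
    using hess_onD[OF assms(1,3)] has_derivative_linear by blast+
  have lin: "linear (G y)" if "y \<in> S" for y
    using hess_onD[OF assms(1) that] has_derivative_linear by blast
  show "linear (\<lambda>v. H x v u)"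
  proof (rule linearI)
    fix v w
    have "((\<lambda>y. G y v + G y w) has_derivative (\<lambda>u. H x v u + H x w u)) (at x)"
      by (intro has_derivative_add hess_onD[OF assms(1,3)])
    then have "((\<lambda>y. G y (v + w)) has_derivative (\<lambda>u. H x v u + H x w u)) (at x)"
      by (rule has_derivative_transform_within_open[OF _ assms(2,3)]) (simp add: linear_add[OF lin])
    from has_derivative_unique[OF this hess_onD(2)[OF assms(1,3)]]
    show "H x (v + w) u = H x v u + H x w u" by (metis)
  next
    fix v and c :: real
    have "((\<lambda>y. c *\<^sub>R G y v) has_derivative (\<lambda>u. c *\<^sub>R H x v u)) (at x)"
      by (intro has_derivative_scaleR_right hess_onD[OF assms(1,3)])
    then have "((\<lambda>y. G y (c *\<^sub>R v)) has_derivative (\<lambda>u. c *\<^sub>R H x v u)) (at x)"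
      by (rule has_derivative_transform_within_open[OF _ assms(2,3)]) (simp add: linear_scale[OF lin])
    from has_derivative_unique[OF this hess_onD(2)[OF assms(1,3)]]
    show "H x (c *\<^sub>R v) u = c *\<^sub>R H x v u" by (metis)
  qed
qed

lemma hess_on_frechet:
  assumes "hess_on S F G H" "open S" "x \<in> S"
  shows "frechet_derivative F (at x) = G x"
    and "frechet_derivative (\<lambda>y. frechet_derivative F (at y) v) (at x) = H x v"
proof -
  show *: "frechet_derivative F (at x) = G x"
    using hess_onD(1)[OF assms(1,3)] by (metis frechet_derivative_at)
  have "frechet_derivative F (at y) = G y" if "y \<in> S" for y
    using hess_onD(1)[OF assms(1) that] by (metis frechet_derivative_at)
  then have "((\<lambda>y. frechet_derivative F (at y) v) has_derivative H x v) (at x)"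
    using has_derivative_transform_within_open[OF hess_onD(2)[OF assms(1,3)] assms(2,3)] by simp
  then show "frechet_derivative (\<lambda>y. frechet_derivative F (at y) v) (at x) = H x v"
    by (metis frechet_derivative_at)
qed

lemma hess_on_diff:
  "hess_on S F G H \<Longrightarrow> hess_on S F' G' H' \<Longrightarrow>
   hess_on S (\<lambda>x. F x - F' x) (\<lambda>x v. G x v - G' x v) (\<lambda>x v u. H x v u - H' x v u)"
  unfolding hess_on_def by (auto intro: has_derivative_diff)

lemma hess_on_bounded_linear:
  assumes "bounded_linear h" "hess_on S F G H"
  shows "hess_on S (\<lambda>x. h (F x)) (\<lambda>x v. h (G x v)) (\<lambda>x v u. h (H x v u))"
  using assms(2) unfolding hess_on_def by (auto intro: bounded_linear.has_derivative[OF assms(1)])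

lemma hess_on_sum:
  "(\<And>i. i \<in> I \<Longrightarrow> hess_on S (F i) (G i) (H i)) \<Longrightarrow>
   hess_on S (\<lambda>x. \<Sum>i\<in>I. F i x) (\<lambda>x v. \<Sum>i\<in>I. G i x v) (\<lambda>x v u. \<Sum>i\<in>I. H i x v u)"
  unfolding hess_on_def by (auto intro: has_derivative_sum)

lemma hess_on_ln:
  fixes F :: "'a::real_normed_vector \<Rightarrow> real"
  assumes "hess_on S F G H" "\<And>x. x \<in> S \<Longrightarrow> F x > 0"
  shows "hess_on S (\<lambda>x. ln (F x)) (\<lambda>x v. G x v / F x)
     (\<lambda>x v u. H x v u / F x - G x v * G x u / (F x)\<^sup>2)"
proof (rule hess_onI)
  fix x assume x: "x \<in> S"
  note F = hess_onD[OF assms(1) x] and pos = assms(2)[OF x]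
  show "((\<lambda>x. ln (F x)) has_derivative (\<lambda>v. G x v / F x)) (at x)"
    using pos by (auto intro!: derivative_eq_intros F(1) simp: field_simps)
  show "((\<lambda>y. G y v / F y) has_derivative (\<lambda>u. H x v u / F x - G x v * G x u / (F x)\<^sup>2)) (at x)" for v
    using pos by (auto intro!: derivative_eq_intros F simp: field_simps power2_eq_square)
qed

text \<open>In \<open>G (\<psi> x) (P x v)\<close> both the base point and the vector depend on x,
  whereas \<open>hess_on\<close> differentiates G only along fixed vectors. Expanding the vector in
  \<open>Basis\<close> reduces the claim to the product rule.\<close>

lemma hess_on_compose:
  fixes F :: "'b::euclidean_space \<Rightarrow> real" and \<psi> :: "'a::real_normed_vector \<Rightarrow> 'b"
  assumes F: "hess_on S F G H" and \<psi>: "hess_on T \<psi> P Q" and S: "open S" and T: "open T"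
    and sub: "\<psi> ` T \<subseteq> S"
  shows "hess_on T (\<lambda>x. F (\<psi> x)) (\<lambda>x v. G (\<psi> x) (P x v))
    (\<lambda>x v u. G (\<psi> x) (Q x v u) + H (\<psi> x) (P x v) (P x u))"
proof (rule hess_onI)
  fix x assume x: "x \<in> T"
  then have y: "\<psi> x \<in> S" using sub by auto
  show "((\<lambda>x. F (\<psi> x)) has_derivative (\<lambda>v. G (\<psi> x) (P x v))) (at x)"
    using diff_chain_at[OF hess_onD(1)[OF \<psi> x] hess_onD(1)[OF F y]] by (simp add: comp_def)
  fix v
  have rep: "f w = (\<Sum>b\<in>Basis. (w \<bullet> b) * f b)" if "linear f" for f :: "'b \<Rightarrow> real" and w
    using linear_sum[OF that, of "\<lambda>b. (w \<bullet> b) *\<^sub>R b" Basis] linear_scale[OF that]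
    by (simp add: euclidean_representation)
  have d1: "((\<lambda>x. G (\<psi> x) b) has_derivative (\<lambda>u. H (\<psi> x) b (P x u))) (at x)" for b
    using diff_chain_at[OF hess_onD(1)[OF \<psi> x] hess_onD(2)[OF F y]] by (simp add: comp_def)
  have "((\<lambda>x. \<Sum>b\<in>Basis. (P x v \<bullet> b) * G (\<psi> x) b) has_derivative
     (\<lambda>u. \<Sum>b\<in>Basis. (P x v \<bullet> b) * H (\<psi> x) b (P x u) + (Q x v u \<bullet> b) * G (\<psi> x) b)) (at x)"
    by (intro has_derivative_sum has_derivative_mult d1 has_derivative_inner_left hess_onD(2)[OF \<psi> x])
  also have "(\<lambda>u. \<Sum>b\<in>Basis. (P x v \<bullet> b) * H (\<psi> x) b (P x u) + (Q x v u \<bullet> b) * G (\<psi> x) b) =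
     (\<lambda>u. G (\<psi> x) (Q x v u) + H (\<psi> x) (P x v) (P x u))"
  proof
    fix u
    have "G (\<psi> x) (Q x v u) = (\<Sum>b\<in>Basis. (Q x v u \<bullet> b) * G (\<psi> x) b)"
      by (rule rep[OF hess_on_linear(1)[OF F S y]])
    moreover have "H (\<psi> x) (P x v) (P x u) = (\<Sum>b\<in>Basis. (P x v \<bullet> b) * H (\<psi> x) b (P x u))"
      by (rule rep[OF hess_on_linear(3)[OF F S y]])
    ultimately show "(\<Sum>b\<in>Basis. (P x v \<bullet> b) * H (\<psi> x) b (P x u) + (Q x v u \<bullet> b) * G (\<psi> x) b) =
      G (\<psi> x) (Q x v u) + H (\<psi> x) (P x v) (P x u)"
      by (simp only: sum.distrib add.commute)
  qed
  finally show "((\<lambda>x. G (\<psi> x) (P x v)) has_derivative (\<lambda>u. G (\<psi> x) (Q x v u) + H (\<psi> x) (P x v) (P x u))) (at x)"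
  proof (rule has_derivative_transform_within_open[OF _ T x])
    fix x' assume "x' \<in> T"
    then have "\<psi> x' \<in> S" using sub by auto
    from rep[OF hess_on_linear(1)[OF F S this], symmetric]
    show "(\<Sum>b\<in>Basis. (P x' v \<bullet> b) * G (\<psi> x') b) = G (\<psi> x') (P x' v)" .
  qed
qed

text \<open>Locally the function is twice the real part of a branch of the logarithm of the
  coordinate. Its Hessian is the real part of a complex bilinear form, so its values on (u, u) and
  (iu, iu) add up to 0; this is the form in which pluriharmonicity is used.\<close>

lemma hess_on_ln_norm_coordinate:
  "hess_on {x. x $ j \<noteq> 0} (\<lambda>x::complex^'n::finite. ln ((cmod (x $ j))\<^sup>2))
     (\<lambda>x v. 2 * Re (v $ j / x $ j)) (\<lambda>x v u. - 2 * Re (v $ j * u $ j / (x $ j)\<^sup>2))"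
proof (rule hess_onI)
  fix x :: "complex^'n" assume x: "x \<in> {x. x $ j \<noteq> 0}"
  have 0: "((\<lambda>x. x $ j) has_derivative (\<lambda>v. v $ j)) (at x)"
    by (rule bounded_linear_imp_has_derivative[OF bounded_linear_vec_nth])
  have nz: "x $ j \<bullet> x $ j > 0" using x by simp
  have eq: "2 * (x $ j \<bullet> v $ j) / (x $ j \<bullet> x $ j) = 2 * Re (v $ j / x $ j)" for v :: "complex^'n"
    by (simp add: inner_complex_def Re_divide power2_eq_square algebra_simps)
  have "((\<lambda>x. ln (x $ j \<bullet> x $ j)) has_derivative (\<lambda>v. 2 * (x $ j \<bullet> v $ j) / (x $ j \<bullet> x $ j))) (at x)"
    using nz by (auto intro!: derivative_eq_intros 0 simp: inner_commute field_simps)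
  then show "((\<lambda>x. ln ((cmod (x $ j))\<^sup>2)) has_derivative (\<lambda>v. 2 * Re (v $ j / x $ j))) (at x)"
    unfolding eq by (simp add: power2_norm_eq_inner)
  show "((\<lambda>y. 2 * Re (v $ j / y $ j)) has_derivative (\<lambda>u. - 2 * Re (v $ j * u $ j / (x $ j)\<^sup>2))) (at x)" for v
    using x by (auto intro!: derivative_eq_intros 0 bounded_linear.has_derivative[OF bounded_linear_Re]
        simp: field_simps power2_eq_square)
qed

lemma Ck_on_2_hess:
  assumes "Ck_on 2 S f"
  shows "hess_on S f (\<lambda>x. frechet_derivative f (at x))
           (\<lambda>x v. frechet_derivative (\<lambda>y. frechet_derivative f (at y) v) (at x))"
    and "continuous_on S f"
    and "continuous_on S (\<lambda>x. frechet_derivative f (at x) v)"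
    and "continuous_on S (\<lambda>x. frechet_derivative (\<lambda>y. frechet_derivative f (at y) v) (at x) u)"
  using assms unfolding hess_on_def numeral_2_eq_2
  by (auto simp: frechet_derivative_works[symmetric] 
       intro!: continuous_at_imp_continuous_on differentiable_imp_continuous_within)

section \<open>Uniform bounds for continuous families of linear and bilinear maps\<close>

text \<open>Continuity is known for each fixed vector only, but the finitely many vectors of
  \<open>Basis\<close> control all others.\<close>

lemma linear_family_bound:
  fixes G :: "'x::topological_space \<Rightarrow> 'a::euclidean_space \<Rightarrow> real"
  assumes "compact K" "\<And>x. x \<in> K \<Longrightarrow> linear (G x)" "\<And>v. continuous_on K (\<lambda>x. G x v)"
  shows "\<exists>C\<ge>0. \<forall>x\<in>K. \<forall>u. \<bar>G x u\<bar> \<le> C * norm u"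
proof -
  have "compact ((\<lambda>x. \<Sum>b\<in>Basis. \<bar>G x b\<bar>) ` K)"
    by (intro compact_continuous_image continuous_intros assms)
  then obtain C where C: "\<And>x. x \<in> K \<Longrightarrow> (\<Sum>b\<in>Basis. \<bar>G x b\<bar>) \<le> C"
    by (meson bounded_imp_bdd_above bdd_above.unfold compact_imp_bounded imageI)
  \<comment> \<open>The maximum with 0 is for empty K, where C may be any real number.\<close>
  have "\<bar>G x u\<bar> \<le> max 0 C * norm u" if x: "x \<in> K" for x u
  proof -
    have "G x u = (\<Sum>b\<in>Basis. (u \<bullet> b) * G x b)"
      using linear_sum[OF assms(2)[OF x], of "\<lambda>b. (u \<bullet> b) *\<^sub>R b" Basis] linear_scale[OF assms(2)[OF x]]
      by (simp add: euclidean_representation)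
    also have "\<bar>\<dots>\<bar> \<le> (\<Sum>b\<in>Basis. norm u * \<bar>G x b\<bar>)"
      by (rule order_trans[OF sum_abs sum_mono]) (simp add: abs_mult mult_right_mono Basis_le_norm)
    also have "\<dots> \<le> norm u * max 0 C"
      using C[OF x] by (simp flip: sum_distrib_left add: mult_left_mono)
    finally show ?thesis by (simp add: mult.commute)
  qed
  then show ?thesis by (intro exI[of _ "max 0 C"]) auto
qed

lemma bilinear_family_bound:
  fixes H :: "'x::topological_space \<Rightarrow> 'a::euclidean_space \<Rightarrow> 'a \<Rightarrow> real"
  assumes "compact K" "\<And>x v. x \<in> K \<Longrightarrow> linear (H x v)" "\<And>x u. x \<in> K \<Longrightarrow> linear (\<lambda>v. H x v u)"
    "\<And>v u. continuous_on K (\<lambda>x. H x v u)"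
  shows "\<exists>C\<ge>0. \<forall>x\<in>K. \<forall>v u. \<bar>H x v u\<bar> \<le> C * norm v * norm u"
proof -
  have "\<forall>b. \<exists>C\<ge>0. \<forall>x\<in>K. \<forall>u. \<bar>H x b u\<bar> \<le> C * norm u"
    using linear_family_bound[OF assms(1), of "\<lambda>x. H x _"] assms(2,4) by blast
  then obtain C where C: "\<And>b. C b \<ge> 0" "\<And>b x u. x \<in> K \<Longrightarrow> \<bar>H x b u\<bar> \<le> C b * norm u"
    by metis
  have "\<bar>H x v u\<bar> \<le> (\<Sum>b\<in>Basis. C b) * norm v * norm u" if x: "x \<in> K" for x v u
  proof -
    have "H x v u = (\<Sum>b\<in>Basis. (v \<bullet> b) * H x b u)"
      using linear_sum[OF assms(3)[OF x], of "\<lambda>b. (v \<bullet> b) *\<^sub>R b" Basis] linear_scale[OF assms(3)[OF x]]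
      by (simp add: euclidean_representation)
    also have "\<bar>\<dots>\<bar> \<le> (\<Sum>b\<in>Basis. norm v * (C b * norm u))"
      by (rule order_trans[OF sum_abs sum_mono])
         (simp add: abs_mult mult_mono Basis_le_norm C(2)[OF x] del: mult.assoc)
    also have "\<dots> = (\<Sum>b\<in>Basis. C b) * norm v * norm u"
      by (simp add: sum_distrib_left sum_distrib_right mult_ac)
    finally show ?thesis .
  qed
  then show ?thesis using C(1) by (intro exI[of _ "\<Sum>b\<in>Basis. C b"]) (auto intro: sum_nonneg)
qed

section \<open>The form dd^c evaluated on pairs (u, iu)\<close>

lemma i_smult_i: "\<i> *s (\<i> *s (u::complex^'n)) = - u"
  by (simp add: vec_eq_iff)

text \<open>For real f the definition gives d^c f (v) = - df (iv) / 4 pi. Taking the exterior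
  derivative on (u, iu) produces - H(i(iu), u) + H(iu, iu) over 4 pi, and i(iu) = -u turns the first
  term into H(u, u).\<close>

lemma ddc_eq_hess:
  fixes f :: "'x \<Rightarrow> real"
  assumes hess: "hess_on S F G H" and S: "open S" and zp: "z p \<in> S"
    and eq: "\<And>x. x \<in> S \<Longrightarrow> f (inv_into V z x) = F x"
  shows "ddc f (V, z) p u (\<i> *s u) =
    complex_of_real ((H (z p) u u + H (z p) (\<i> *s u) (\<i> *s u)) / (4 * pi))"
proof -
  define a where "a = z p"
  have a: "a \<in> S" using zp by (simp add: a_def)
  define fc where "fc = (\<lambda>x. complex_of_real (f (inv_into V z x)))"
  have hc: "hess_on S fc (\<lambda>x v. complex_of_real (G x v)) (\<lambda>x v u. complex_of_real (H x v u))"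
    by (rule hess_on_cong[OF hess_on_bounded_linear[OF bounded_linear_of_real hess] S])
       (simp add: fc_def eq)
  have dc: "d_c fc x v = - complex_of_real (G x (\<i> *s v)) / (4 * pi)" if "x \<in> S" for x v
    unfolding d_c_def del_def delbar_def hess_on_frechet(1)[OF hc S that]
    by (simp add: field_simps)
  have "((\<lambda>x. d_c fc x v) has_derivative (\<lambda>u. - complex_of_real (H a (\<i> *s v) u) / (4 * pi))) (at a)" for v
  proof -
    have "((\<lambda>x. - complex_of_real (G x (\<i> *s v)) / (4 * pi)) has_derivative
        (\<lambda>u. - complex_of_real (H a (\<i> *s v) u) / (4 * pi))) (at a)"
      by (rule bounded_linear.has_derivative[OF bounded_linear_divide has_derivative_minus[OF hess_onD(2)[OF hc a]]])
    then show ?thesis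
      by (rule has_derivative_transform_within_open[OF _ S a]) (simp add: dc)
  qed
  then have fd: "frechet_derivative (\<lambda>x. d_c fc x v) (at a) = (\<lambda>u. - complex_of_real (H a (\<i> *s v) u) / (4 * pi))" for v
    by (metis frechet_derivative_at)
  have "H a (- u) u = - H a u u"
    using linear_neg[OF hess_on_linear(3)[OF hess S a]] by blast
  then show ?thesis
    unfolding ddc_def ext_d_def a_def[symmetric] fc_def[symmetric] prod.case fd i_smult_i
    by (simp add: add_divide_distrib)
qed

section \<open>Charts and local equations\<close>

lemma holo_on_cong:
  assumes "holo_on S f" "open S" "\<And>x. x \<in> S \<Longrightarrow> f x = g x"
  shows "holo_on S g"
  using assms unfolding holo_on_def by (meson has_derivative_transform_within_open)

lemma has_derivative_vecI:
  fixes f :: "'a::real_normed_vector \<Rightarrow> complex^'n::finite"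
  assumes "\<And>i. ((\<lambda>x. f x $ i) has_derivative (\<lambda>v. f' v $ i)) (at x)"
  shows "(f has_derivative f') (at x)"
  unfolding has_derivative_componentwise_within[of f f' x UNIV] Basis_vec_def
  by (auto simp: inner_axis intro!: has_derivative_inner_left assms)

text \<open>The second derivative of a holomorphic map is complex linear in each argument: in the
  second because first derivatives are again holomorphic, in the first by differentiating P(iv) = i
  P(v). Two factors i give the sign.\<close>

lemma holo_components_hess:
  fixes \<psi> :: "complex^'n::finite \<Rightarrow> complex^'n"
  assumes hol: "\<And>i. holo_on T (\<lambda>x. \<psi> x $ i)" and T: "open T"
  obtains P Q where "hess_on T \<psi> P Q"
    and "\<And>x c v. x \<in> T \<Longrightarrow> P x (c *s v) = c *s P x v"
    and "\<And>x v. x \<in> T \<Longrightarrow> Q x (\<i> *s v) (\<i> *s v) = - Q x v v"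
proof
  define P where "P = (\<lambda>x v. \<chi> i. frechet_derivative (\<lambda>x. \<psi> x $ i) (at x) v)"
  define Q where "Q = (\<lambda>x v u. \<chi> i. frechet_derivative (\<lambda>y. frechet_derivative (\<lambda>x. \<psi> x $ i) (at y) v) (at x) u)"
  note hol' = holo_on_derivative[OF hol T]
  show *: "hess_on T \<psi> P Q"
    by (intro hess_onI has_derivative_vecI)
       (simp_all add: P_def Q_def holo_on_has_derivative(1)[OF hol] holo_on_has_derivative(1)[OF hol'])
  show P: "P x (c *s v) = c *s P x v" if "x \<in> T" for x c v
    using that by (simp add: P_def vec_eq_iff holo_on_has_derivative(2)[OF hol])
  show "Q x (\<i> *s v) (\<i> *s v) = - Q x v v" if x: "x \<in> T" for x v
  proof -
    have "((\<lambda>y. \<i> *s P y v) has_derivative (\<lambda>u. \<i> *s Q x v u)) (at x)"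
      by (rule bounded_linear.has_derivative[OF bounded_linear_smult_right hess_onD(2)[OF * x]])
    then have "((\<lambda>y. P y (\<i> *s v)) has_derivative (\<lambda>u. \<i> *s Q x v u)) (at x)"
      by (rule has_derivative_transform_within_open[OF _ T x]) (simp add: P)
    from has_derivative_unique[OF this hess_onD(2)[OF * x]]
    have "Q x (\<i> *s v) u = \<i> *s Q x v u" for u by metis
    moreover have "Q x v (\<i> *s v) = \<i> *s Q x v v"
      using x by (simp add: Q_def vec_eq_iff holo_on_has_derivative(2)[OF hol'])
    ultimately show ?thesis by (simp add: i_smult_i)
  qed
qed

lemma
  assumes "is_chart (V, z)"
  shows chart_open: "open V"
    and chart_inj: "inj_on z V"
    and chart_inv: "p \<in> V \<Longrightarrow> inv_into V z (z p) = p"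
    and chart_open_image: "open U \<Longrightarrow> open (z ` (V \<inter> U))"
    and chart_continuous: "continuous_on V z"
    and chart_continuous_inv: "continuous_on (z ` V) (inv_into V z)"
proof -
  have h: "homeomorphism V (z ` V) z (inv_into V z)" and o: "open V" "open (z ` V)"
    using assms by (auto simp: is_chart_def)
  show "open V" "continuous_on V z" "continuous_on (z ` V) (inv_into V z)"
    using h o by (auto simp: homeomorphism_def)
  show inv: "inv_into V z (z p) = p" if "p \<in> V" for p
    using h that by (auto simp: homeomorphism_def)
  show "inj_on z V" by (metis inj_onI inv)
  show "open (z ` (V \<inter> U))" if "open U"
    using homeomorphism_imp_open_map[OF h, of "V \<inter> U"] that o
    by (metis openin_open_Int openin_open_trans)
qed

lemma
  assumes "complex_structure atl"
  shows atlas_chart: "c \<in> atl \<Longrightarrow> is_chart c"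
    and atlas_transition: "\<lbrakk>(V, z) \<in> atl; (W, w) \<in> atl\<rbrakk> \<Longrightarrow>
          holo_on (z ` (V \<inter> W)) (\<lambda>x. transition (V, z) (W, w) x $ i)"
    and atlas_maximal: "\<lbrakk>is_chart c; \<And>d. d \<in> atl \<Longrightarrow> holo_compatible c d\<rbrakk> \<Longrightarrow> c \<in> atl"
proof -
  show "c \<in> atl \<Longrightarrow> is_chart c" using assms by (auto simp: complex_structure_def)
  show "is_chart c \<Longrightarrow> (\<And>d. d \<in> atl \<Longrightarrow> holo_compatible c d) \<Longrightarrow> c \<in> atl"
    using assms unfolding complex_structure_def by blast
  assume "(V, z) \<in> atl" "(W, w) \<in> atl"
  then have "holo_compatible (V, z) (W, w)" using assms unfolding complex_structure_def by blast
  then show "holo_on (z ` (V \<inter> W)) (\<lambda>x. transition (V, z) (W, w) x $ i)"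
    by (simp add: holo_compatible_def)
qed

lemma transition_apply: "is_chart (V, z) \<Longrightarrow> p \<in> V \<Longrightarrow> transition (V, z) (W, w) (z p) = w p"
  by (simp add: transition_def chart_inv)

text \<open>Covariance of \<open>ddc\<close>, from second-order data of f in the chart (V, z) alone.
  The chain rule produces the Hessian on J u and a first-order term containing Q, and Q(iu, iu) = -
  Q(u, u) makes the latter vanish on the pair.\<close>

lemma ddc_transition:
  fixes atl :: "('x::t2_space, 'n::finite) chart set" and f :: "'x \<Rightarrow> real"
  assumes cs: "complex_structure atl" and c: "(W, w) \<in> atl" and d: "(V, z) \<in> atl"
    and p: "p \<in> W" "p \<in> V"
    and hess: "hess_on S F G H" and S: "open S" and zp: "z p \<in> S"
    and eq: "\<And>x. x \<in> S \<Longrightarrow> f (inv_into V z x) = F x"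
  defines "J \<equiv> frechet_derivative (transition (W, w) (V, z)) (at (w p))"
  shows "ddc f (W, w) p u (\<i> *s u) = ddc f (V, z) p (J u) (\<i> *s J u)"
    and "J (\<i> *s u) = \<i> *s J u"
proof -
  define \<psi> where "\<psi> = transition (W, w) (V, z)"
  define T where "T = w ` (W \<inter> V)"
  note chW = atlas_chart[OF cs c] and chV = atlas_chart[OF cs d]
  have T: "open T" unfolding T_def by (rule chart_open_image[OF chW chart_open[OF chV]])
  obtain P Q where \<psi>: "hess_on T \<psi> P Q"
    and P: "\<And>x c v. x \<in> T \<Longrightarrow> P x (c *s v) = c *s P x v"
    and Q: "\<And>x v. x \<in> T \<Longrightarrow> Q x (\<i> *s v) (\<i> *s v) = - Q x v v"
    using holo_components_hess[OF _ T, of \<psi>] atlas_transition[OF cs c d] 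
    unfolding \<psi>_def T_def by metis
  have wp: "w p \<in> T" using p by (auto simp: T_def)
  have \<psi>wp: "\<psi> (w p) = z p" using transition_apply[OF chW p(1)] by (simp add: \<psi>_def)
  have J: "J = P (w p)"
    using hess_on_frechet(1)[OF \<psi> T wp] by (simp add: J_def \<psi>_def)
  show "J (\<i> *s u) = \<i> *s J u" using P[OF wp] by (simp add: J)
  have cont: "continuous_on T \<psi>"
    using hess_onD(1)[OF \<psi>] by (meson continuous_at_imp_continuous_on has_derivative_continuous)
  \<comment> \<open>The part of the overlap that the transition maps into S, where derivatives of f
    are available.\<close>
  define T' where "T' = T \<inter> \<psi> -` S"
  have T': "open T'" unfolding T'_def by (rule continuous_open_preimage[OF cont T S])
  have wp': "w p \<in> T'" using wp zp \<psi>wp by (simp add: T'_def)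
  have hc: "hess_on T' (\<lambda>x. F (\<psi> x)) (\<lambda>x v. G (\<psi> x) (P x v))
    (\<lambda>x v u. G (\<psi> x) (Q x v u) + H (\<psi> x) (P x v) (P x u))"
    by (rule hess_on_compose[OF hess hess_on_subset[OF \<psi>] S T']) (auto simp: T'_def)
  have "f (inv_into W w x) = F (\<psi> x)" if "x \<in> T'" for x
  proof -
    obtain q where q: "q \<in> W" "q \<in> V" "x = w q" using \<open>x \<in> T'\<close> by (auto simp: T'_def T_def)
    have "\<psi> x = z q" using transition_apply[OF chW q(1)] q by (simp add: \<psi>_def)
    then show ?thesis
      using eq[of "z q"] that q chart_inv[OF chW q(1)] chart_inv[OF chV q(2)] by (simp add: T'_def)
  qed
  from ddc_eq_hess[of _ _ _ _ w p f, OF hc T' wp' this]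
  have "ddc f (W, w) p u (\<i> *s u) = complex_of_real ((G (z p) (Q (w p) u u + - Q (w p) u u)
      + (H (z p) (J u) (J u) + H (z p) (\<i> *s J u) (\<i> *s J u))) / (4 * pi))"
    unfolding linear_add[OF hess_on_linear(1)[OF hess S zp]]
    by (simp only: \<psi>wp Q[OF wp] P[OF wp] J) (simp add: algebra_simps)
  also have "\<dots> = complex_of_real ((H (z p) (J u) (J u) + H (z p) (\<i> *s J u) (\<i> *s J u)) / (4 * pi))"
    using linear_0[OF hess_on_linear(1)[OF hess S zp]] by simp
  also have "\<dots> = ddc f (V, z) p (J u) (\<i> *s J u)"
    by (rule ddc_eq_hess[of _ _ _ _ z p f, OF hess S zp eq, symmetric])
  finally show "ddc f (W, w) p u (\<i> *s u) = ddc f (V, z) p (J u) (\<i> *s J u)" .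
qed

text \<open>Adapted charts have coordinates of modulus below 1/e, which a chart provided by
  \<open>snc_divisor\<close> may violate. Moving a point to the origin and shrinking the domain
  repairs this, and maximality keeps the result in the atlas.\<close>

lemma chart_restrict_translate:
  fixes atl :: "('x::t2_space, 'n::finite) chart set"
  assumes cs: "complex_structure atl" and V: "(V, z) \<in> atl" and U: "open U"
  shows "(V \<inter> U, \<lambda>p. z p - c) \<in> atl"
proof (rule atlas_maximal[OF cs])
  note ch = atlas_chart[OF cs V]
  define z' where "z' = (\<lambda>p. z p - c)"
  have inj: "inj_on z' (V \<inter> U)"
    using chart_inj[OF ch] by (auto simp: z'_def inj_on_def)
  have inv': "inv_into (V \<inter> U) z' y = inv_into V z (y + c)" if y: "y \<in> z' ` (V \<inter> U)" for y
    using y inv_into_f_f[OF inj] chart_inv[OF ch] by (auto simp: z'_def)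
  have img: "z' ` A = (\<lambda>x. x - c) ` z ` A" for A by (auto simp: z'_def image_image)
  have opn: "open (z' ` (V \<inter> A))" if "open A" for A
    unfolding img by (rule open_translation_subtract[OF chart_open_image[OF ch that]])
  show "is_chart (V \<inter> U, \<lambda>p. z p - c)"
    unfolding is_chart_def prod.case z'_def[symmetric] homeomorphism_def
  proof (intro conjI ballI)
    show "continuous_on (V \<inter> U) z'"
      unfolding z'_def
      by (intro continuous_intros continuous_on_subset[OF chart_continuous[OF ch]]) auto
    have "continuous_on (z' ` (V \<inter> U)) (\<lambda>y. inv_into V z (y + c))"
      by (intro continuous_on_compose2[OF chart_continuous_inv[OF ch]] continuous_intros)
         (auto simp: z'_def)
    then show "continuous_on (z' ` (V \<inter> U)) (inv_into (V \<inter> U) z')"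
      by (rule continuous_on_eq) (simp add: inv')
    show "inv_into (V \<inter> U) z' ` z' ` (V \<inter> U) = V \<inter> U"
      using inv_into_f_f[OF inj] by (force simp: image_image)
  qed (use chart_open[OF ch] U opn[OF U] inv_into_f_f[OF inj] f_inv_into_f in \<open>auto simp: image_image\<close>)
  fix d assume d: "d \<in> atl"
  obtain W w where dW: "d = (W, w)" by (cases d)
  note W = d[unfolded dW]
  have oW: "open W" using chart_open[OF atlas_chart[OF cs W]] .
  show "holo_compatible (V \<inter> U, \<lambda>p. z p - c) d"
    unfolding holo_compatible_def dW fst_conv snd_conv z'_def[symmetric]
  proof (intro conjI allI)
    fix i
    have o1: "open (z' ` (V \<inter> U \<inter> W))" using opn[of "U \<inter> W"] U oW by (simp add: Int_assoc open_Int)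
    have "holo_on (z' ` (V \<inter> U \<inter> W)) (\<lambda>x. transition (V, z) (W, w) (x + c) $ i)"
      unfolding holo_on_def
    proof
      fix y assume "y \<in> z' ` (V \<inter> U \<inter> W)"
      then have "y + c \<in> z ` (V \<inter> W)" by (auto simp: z'_def)
      then obtain f' where f': "((\<lambda>x. transition (V, z) (W, w) x $ i) has_derivative f') (at (y + c))"
        "\<forall>c u. f' (c *s u) = c * f' u"
        using atlas_transition[OF cs V W] unfolding holo_on_def by blast
      have "((\<lambda>x. x + c) has_derivative (\<lambda>u. u)) (at y)" by (auto intro!: derivative_eq_intros)
      from diff_chain_at[OF this f'(1)] f'(2)
      show "\<exists>f'. ((\<lambda>x. transition (V, z) (W, w) (x + c) $ i) has_derivative f') (at y) \<and> (\<forall>c u. f' (c *s u) = c * f' u)"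
        by (auto simp: comp_def)
    qed
    then show "holo_on (z' ` (V \<inter> U \<inter> W)) (\<lambda>x. transition (V \<inter> U, z') (W, w) x $ i)"
      by (rule holo_on_cong[OF _ o1]) (auto simp: transition_def inv')
  next
    fix i
    have "holo_on (w ` (V \<inter> U \<inter> W)) (\<lambda>x. transition (W, w) (V, z) x $ i)"
      by (rule holo_on_subset[OF atlas_transition[OF cs W V]]) auto
    then have "holo_on (w ` (V \<inter> U \<inter> W)) (\<lambda>x. transition (W, w) (V, z) x $ i - c $ i)"
      unfolding holo_on_def using has_derivative_diff[OF _ has_derivative_const[of "c $ i"]]
      by (metis (no_types, lifting) diff_zero ext)
    then show "holo_on (w ` (V \<inter> U \<inter> W)) (\<lambda>x. transition (W, w) (V \<inter> U, z') x $ i)"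
      by (simp add: transition_def z'_def)
  qed
qed

section \<open>Local equations and norms of sections\<close>

text \<open>Vanishing to order 1 has to be verified in every chart of the atlas: the transition to
  (V, z) has an invertible differential, so none of its component differentials is zero.\<close>

lemma coordinate_local_equation:
  fixes atl :: "('x::t2_space, 'n::finite) chart set"
  assumes cs: "complex_structure atl" and V: "(V, z) \<in> atl"
    and D: "\<And>p. p \<in> V \<Longrightarrow> z p $ j = 0 \<longleftrightarrow> p \<in> D"
  shows "(V, \<lambda>p. z p $ j) \<in> local_equations atl D"
  unfolding local_equations_def mem_Collect_eq prod.case
proof (intro conjI ballI)
  note ch = atlas_chart[OF cs V]
  show "open V" by (rule chart_open[OF ch])
  have tr: "(\<lambda>p. z p $ j) \<circ> inv_into W w = (\<lambda>x. transition (W, w) (V, z) x $ j)" for W w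
    by (auto simp: transition_def)
  show "holo_fun atl V (\<lambda>p. z p $ j)"
    unfolding holo_fun_def using atlas_transition[OF cs _ V] by (auto simp: tr)
  fix d assume d: "d \<in> atl"
  obtain W w where dW: "d = (W, w)" by (cases d)
  note W = d[unfolded dW] and chW = atlas_chart[OF cs d[unfolded dW]]
  show "case d of (W, w) \<Rightarrow> \<forall>p\<in>W \<inter> V \<inter> D. \<exists>u. frechet_derivative ((\<lambda>p. z p $ j) \<circ> inv_into W w) (at (w p)) u \<noteq> 0"
    unfolding dW prod.case tr
  proof
    fix p assume p: "p \<in> W \<inter> V \<inter> D"
    define A where "A = w ` (W \<inter> V)"
    define B where "B = z ` (V \<inter> W)"
    have oA: "open A" unfolding A_def by (rule chart_open_image[OF chW chart_open[OF ch]])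
    have oB: "open B" unfolding B_def by (rule chart_open_image[OF ch chart_open[OF chW]])
    obtain P1 Q1 where P1: "hess_on A (transition (W, w) (V, z)) P1 Q1"
      using holo_components_hess[OF _ oA] atlas_transition[OF cs W V] unfolding A_def by metis
    obtain P2 Q2 where P2: "hess_on B (transition (V, z) (W, w)) P2 Q2"
      using holo_components_hess[OF _ oB] atlas_transition[OF cs V W] unfolding B_def by metis
    have wp: "w p \<in> A" and zp: "z p \<in> B" using p by (auto simp: A_def B_def)
    have "transition (V, z) (W, w) (z p) = w p" using p by (simp add: transition_apply[OF ch])
    \<comment> \<open>Going from z to w and back is the identity near z p, so P1 after P2 is the
      identity; the vector P2 (axis j 1) then has j-th derivative 1.\<close>
    then have "(transition (W, w) (V, z) \<circ> transition (V, z) (W, w) has_derivative P1 (w p) \<circ> P2 (z p)) (at (z p))"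
      using diff_chain_at[OF hess_onD(1)[OF P2 zp], of "transition (W, w) (V, z)" "P1 (w p)"] hess_onD(1)[OF P1 wp] by simp
    then have "((\<lambda>x. x) has_derivative P1 (w p) \<circ> P2 (z p)) (at (z p))"
      by (rule has_derivative_transform_within_open[OF _ oB zp])
         (auto simp: B_def transition_apply[OF ch] transition_apply[OF chW])
    then have inv: "P1 (w p) (P2 (z p) v) = v" for v
      using has_derivative_unique[OF _ has_derivative_ident] by (metis comp_apply)
    have "((\<lambda>x. transition (W, w) (V, z) x $ j) has_derivative (\<lambda>v. P1 (w p) v $ j)) (at (w p))"
      by (rule bounded_linear.has_derivative[OF bounded_linear_vec_nth hess_onD(1)[OF P1 wp]])
    then have "frechet_derivative (\<lambda>x. transition (W, w) (V, z) x $ j) (at (w p)) (P2 (z p) (axis j 1)) = 1"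
      using inv[of "axis j 1"] by (simp add: frechet_derivative_at[symmetric])
    then show "\<exists>u. frechet_derivative (\<lambda>x. transition (W, w) (V, z) x $ j) (at (w p)) u \<noteq> 0"
      by (metis zero_neq_one)
  qed
qed (use D in auto)

text \<open>Trivialises the bundle of a component that misses the chart, so that such components
  fall under the same local formula for the norm, with vanishing logarithmic term.\<close>

lemma one_local_equation:
  assumes "open V" "V \<inter> D = {}"
  shows "(V, \<lambda>p. 1) \<in> local_equations atl D"
proof -
  have "holo_on S (\<lambda>x. 1)" for S
    unfolding holo_on_def by (auto intro!: exI[of _ "\<lambda>_. 0"])
  then show ?thesis
    using assms by (auto simp: local_equations_def holo_fun_def comp_def)
qed

text \<open>With \<open>t = \<sigma>\<^sub>f\<close>, which is again a local equation, the law \<open>h\<^sub>f |f|\<^sup>2 = h\<^sub>t |t|\<^sup>2\<close>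
  expresses \<open>|t|\<^sup>2\<close> by \<open>|f|\<^sup>2\<close>, so the quotient \<open>t / f\<close> need not be extended across \<open>D\<close>.\<close>

lemma norm_sq_local:
  assumes gs: "global_section atl D \<sigma>" and dv: "div_eq atl D \<sigma>" and hm: "hermitian_metric atl D h"
    and f: "(U, f) \<in> local_equations atl D" and p: "p \<in> U" "p \<notin> D"
  shows "norm_sq atl D h \<sigma> p = (h (U, f) p)\<^sup>2 / h (U, \<sigma> (U, f)) p * (cmod (f p))\<^sup>2"
proof -
  \<comment> \<open>\<open>norm_sq\<close> evaluates the norm in an unspecified trivialisation e;
    the transition laws carry the value back to (U, f).\<close>
  define e where "e = (SOME e. e \<in> local_equations atl D \<and> p \<in> fst e)"
  have e: "e \<in> local_equations atl D \<and> p \<in> fst e"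
    unfolding e_def by (rule someI[of _ "(U, f)"]) (use f p in auto)
  obtain W g where eW: "e = (W, g)" by (cases e)
  have g: "(W, g) \<in> local_equations atl D" "p \<in> W" using e by (auto simp: eW)
  have fnz: "f p \<noteq> 0" and gnz: "g p \<noteq> 0"
    using f g p by (auto simp: local_equations_def)
  define t where "t = \<sigma> (U, f)"
  have t: "(U, t) \<in> local_equations atl D"
    using dv f by (auto simp: div_eq_def t_def)
  have pos: "h (U, t) p > 0" using hm t p by (auto simp: hermitian_metric_def)
  have h1: "h (U, f) p * (cmod (f p))\<^sup>2 = h (W, g) p * (cmod (g p))\<^sup>2"
   and h2: "h (U, f) p * (cmod (f p))\<^sup>2 = h (U, t) p * (cmod (t p))\<^sup>2"
    using hm f g t p unfolding hermitian_metric_def by fast+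
  have "t p * g p = \<sigma> (W, g) p * f p"
    using gs f g p unfolding global_section_def t_def by fast
  then have "(cmod (t p))\<^sup>2 * (cmod (g p))\<^sup>2 = (cmod (\<sigma> (W, g) p))\<^sup>2 * (cmod (f p))\<^sup>2"
    by (metis norm_mult power_mult_distrib)
  then have 1: "h (W, g) p * (cmod (\<sigma> (W, g) p))\<^sup>2 * (cmod (f p))\<^sup>2 = h (W, g) p * (cmod (g p))\<^sup>2 * (cmod (t p))\<^sup>2"
    by (simp add: mult.assoc mult.commute[of "(cmod (g p))\<^sup>2"])
  have "norm_sq atl D h \<sigma> p = h (W, g) p * (cmod (\<sigma> (W, g) p))\<^sup>2"
    by (simp add: norm_sq_def e_def[symmetric] eW Let_def)
  also have "\<dots> = h (U, f) p * (cmod (t p))\<^sup>2"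
    using 1 fnz unfolding h1[symmetric] by simp
  also have "(cmod (t p))\<^sup>2 = h (U, f) p * (cmod (f p))\<^sup>2 / h (U, t) p"
    using h2 pos by simp
  finally show ?thesis by (simp add: t_def power2_eq_square)
qed

text \<open>Taking logarithms in the previous formula gives R = ln h_t - 2 ln h_f with t the
  expression of the section. Both weights are smooth and positive on all of V, so R and its
  derivatives stay bounded near the divisor; the whole singularity sits in ln |f|^2.\<close>

lemma norm_sq_log_local:
  fixes atl :: "('x::t2_space, 'n::finite) chart set"
  assumes V: "(V, z) \<in> atl" and ch: "is_chart (V, z)"
    and gs: "global_section atl D \<sigma>" and dv: "div_eq atl D \<sigma>" and hm: "hermitian_metric atl D h"
    and f: "(V, f) \<in> local_equations atl D"
  obtains R G H where "hess_on (z ` V) R G H" "continuous_on (z ` V) R"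
    "\<And>v. continuous_on (z ` V) (\<lambda>x. G x v)" "\<And>v u. continuous_on (z ` V) (\<lambda>x. H x v u)"
    "\<And>p. p \<in> V - D \<Longrightarrow> norm_sq atl D h \<sigma> p > 0 \<and>
       ln (inverse (norm_sq atl D h \<sigma> p)) = R (z p) - ln ((cmod (f p))\<^sup>2)"
proof -
  define t where "t = \<sigma> (V, f)"
  have t: "(V, t) \<in> local_equations atl D"
    using dv f by (auto simp: div_eq_def t_def)
  have pos: "h (V, f) p > 0" "h (V, t) p > 0" if "p \<in> V" for p 
    using hm t f that by (auto simp: hermitian_metric_def)
  define F where "F = (\<lambda>g. h (V, g) \<circ> inv_into V z)"
  have posF: "F f x > 0" "F t x > 0" if "x \<in> z ` V" for x
    using that pos by (auto simp: F_def inv_into_into)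
  have ck: "Ck_on 2 (z ` V) (F g)" if "g = f \<or> g = t" for g
  proof -
    have "smooth_fun atl V (h (V, g))"
      using hm t f that by (auto simp: hermitian_metric_def)
    then have "Cinf_on (z ` (V \<inter> V)) (F g)"
      using V unfolding smooth_fun_def F_def by blast
    then show ?thesis by (simp add: Cinf_on_def)
  qed
  define G where "G = (\<lambda>g x. frechet_derivative (F g) (at x))"
  define H where "H = (\<lambda>g x v. frechet_derivative (\<lambda>y. G g y v) (at x))"
  have hs: "hess_on (z ` V) (F g) (G g) (H g)" if "g = f \<or> g = t" for g
    using Ck_on_2_hess(1)[OF ck[OF that]] by (simp add: G_def H_def)
  have cont: "continuous_on (z ` V) (F g)" "continuous_on (z ` V) (\<lambda>x. G g x v)" 
     "continuous_on (z ` V) (\<lambda>x. H g x v u)" if "g = f \<or> g = t" for g v u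
    using Ck_on_2_hess(2-)[OF ck[OF that]] by (simp_all add: G_def H_def)
  have "hess_on (z ` V) (F f) (G f) (H f)" "hess_on (z ` V) (F t) (G t) (H t)"
    using hs by blast+
  note hl = hess_on_ln[OF this(1) posF(1)] hess_on_ln[OF this(2) posF(2)]
  show thesis
  proof (rule that[OF hess_on_diff[OF hl(2) hess_on_bounded_linear[OF bounded_linear_mult_right[of 2] hl(1)]]])
    show "continuous_on (z ` V) (\<lambda>x. ln (F t x) - 2 * ln (F f x))"
      by (intro continuous_intros cont) (use posF in \<open>auto simp: less_imp_neq[symmetric]\<close>)
    show "continuous_on (z ` V) (\<lambda>x. G t x v / F t x - 2 * (G f x v / F f x))" for v
      by (intro continuous_intros cont) (use posF in \<open>auto simp: less_imp_neq[symmetric]\<close>)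
    show "continuous_on (z ` V) (\<lambda>x. H t x v u / F t x - G t x v * G t x u / (F t x)\<^sup>2 -
             2 * (H f x v u / F f x - G f x v * G f x u / (F f x)\<^sup>2))" for v u
      by (intro continuous_intros cont) (use posF in \<open>auto simp: less_imp_neq[symmetric]\<close>)
    fix p assume p: "p \<in> V - D"
    have fnz: "f p \<noteq> 0" using f p by (auto simp: local_equations_def)
    have ns: "norm_sq atl D h \<sigma> p = (h (V, f) p)\<^sup>2 / h (V, t) p * (cmod (f p))\<^sup>2"
      using norm_sq_local[OF gs dv hm f] p by (simp add: t_def)
    have Fp: "F g (z p) = h (V, g) p" for g using chart_inv[OF ch, of p] p by (simp add: F_def)
    show "norm_sq atl D h \<sigma> p > 0 \<and> ln (inverse (norm_sq atl D h \<sigma> p)) =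
       (ln (F t (z p)) - 2 * ln (F f (z p))) - ln ((cmod (f p))\<^sup>2)"
      using pos[of p] p fnz unfolding ns Fp
      by (simp add: ln_inverse ln_mult ln_div ln_realpow)
  qed
qed

section \<open>Estimates in an adapted chart\<close>

text \<open>In the applications r1 and r2 are the derivatives of R along u and iu, n = |u|, w = u_j
  / x_j, and l is the Hessian of L summed over (u, u) and (iu, iu). The cross terms are removed by
  (a - 2b)^2 >= 2 b^2 - a^2, the squares of Re w and Re (iw) add up to |w|^2, and L >= 1 removes the
  denominators from the error terms.\<close>

lemma weight_ineq:
  fixes L C n :: real
  assumes "L \<ge> 1" "C \<ge> 0" and r: "\<bar>r1\<bar> \<le> C * n" "\<bar>r2\<bar> \<le> C * n" and l: "\<bar>l\<bar> \<le> 2 * C * n\<^sup>2"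
  shows "((r1 - 2 * Re w)\<^sup>2 + (r2 - 2 * Re (\<i> * w))\<^sup>2) / L\<^sup>2 - l / L
     \<ge> 2 * (cmod w)\<^sup>2 / L\<^sup>2 - (2 * C + 2 * C\<^sup>2) * n\<^sup>2"
proof -
  have sq: "(a - 2 * b)\<^sup>2 \<ge> 2 * b\<^sup>2 - a\<^sup>2" for a b :: real
    using zero_le_power2[of "a - b"] by (simp add: power2_eq_square algebra_simps)
  have r': "r1\<^sup>2 \<le> C\<^sup>2 * n\<^sup>2" "r2\<^sup>2 \<le> C\<^sup>2 * n\<^sup>2"
    using r power_mono[of "\<bar>r1\<bar>" "C * n" 2] power_mono[of "\<bar>r2\<bar>" "C * n" 2]
    by (auto simp: power_mult_distrib)
  have "2 * (cmod w)\<^sup>2 - 2 * C\<^sup>2 * n\<^sup>2 \<le> (r1 - 2 * Re w)\<^sup>2 + (r2 - 2 * Re (\<i> * w))\<^sup>2"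
    using sq[of "Re w" r1] sq[of "Re (\<i> * w)" r2] r' by (simp add: cmod_power2)
  then have "(2 * (cmod w)\<^sup>2 - 2 * C\<^sup>2 * n\<^sup>2) / L\<^sup>2 \<le> ((r1 - 2 * Re w)\<^sup>2 + (r2 - 2 * Re (\<i> * w))\<^sup>2) / L\<^sup>2"
    by (rule divide_right_mono) simp
  moreover have "2 * C\<^sup>2 * n\<^sup>2 / L\<^sup>2 \<le> 2 * C\<^sup>2 * n\<^sup>2"
    using divide_left_mono[of 1 "L\<^sup>2" "2 * C\<^sup>2 * n\<^sup>2"] assms(1) by (simp add: one_le_power)
  moreover have "l / L \<le> 2 * C * n\<^sup>2"
  proof -
    have "l / L \<le> \<bar>l\<bar>"
      using assms(1) by (simp add: divide_le_eq) (smt (verit) mult_le_cancel_left1)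
    then show ?thesis using l by simp
  qed
  ultimately show ?thesis
    by (simp add: diff_divide_distrib algebra_simps)
qed

lemma hess_on_minus_ln:
  fixes L :: "'a::real_normed_vector \<Rightarrow> real"
  assumes "hess_on S L G H" "\<And>x. x \<in> S \<Longrightarrow> L x > 0"
  shows "hess_on S (\<lambda>x. - ln (L x)) (\<lambda>x v. - (G x v / L x))
     (\<lambda>x v u. - (H x v u / L x - G x v * G x u / (L x)\<^sup>2))"
  by (rule hess_on_bounded_linear[OF bounded_linear_minus[OF bounded_linear_ident] hess_on_ln[OF assms]])

lemma hess_bounds:
  fixes R :: "complex^'n::finite \<Rightarrow> real"
  assumes R: "hess_on S R G H" "open S" "continuous_on S R" "\<And>v. continuous_on S (\<lambda>x. G x v)"
      "\<And>v u. continuous_on S (\<lambda>x. H x v u)"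
    and K: "compact K" "K \<subseteq> S"
  obtains C where "C \<ge> 0" "\<And>x. x \<in> K \<Longrightarrow> \<bar>R x\<bar> \<le> C"
    "\<And>x u. x \<in> K \<Longrightarrow> \<bar>G x u\<bar> \<le> C * norm u \<and> \<bar>G x (\<i> *s u)\<bar> \<le> C * norm u"
    "\<And>x u. x \<in> K \<Longrightarrow> \<bar>H x u u + H x (\<i> *s u) (\<i> *s u)\<bar> \<le> 2 * C * (norm u)\<^sup>2"
proof -
  have inS: "x \<in> S" if "x \<in> K" for x using that K by auto
  have "compact (R ` K)"
    by (rule compact_continuous_image[OF continuous_on_subset[OF R(3) K(2)] K(1)])
  then obtain C1 where C1: "\<And>x. x \<in> K \<Longrightarrow> \<bar>R x\<bar> \<le> C1"
    using compact_imp_bounded[of "R ` K"] unfolding bounded_iff by (metis imageI real_norm_def)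
  obtain C2 where C2: "C2 \<ge> 0" "\<And>x u. x \<in> K \<Longrightarrow> \<bar>G x u\<bar> \<le> C2 * norm u"
    using linear_family_bound[OF K(1) hess_on_linear(1)[OF R(1,2) inS], of "\<lambda>x. x"]
      continuous_on_subset[OF R(4) K(2)] by blast
  obtain C3 where C3: "C3 \<ge> 0" "\<And>x v u. x \<in> K \<Longrightarrow> \<bar>H x v u\<bar> \<le> C3 * norm v * norm u"
    using bilinear_family_bound[OF K(1), of H] hess_on_linear(2,3)[OF R(1,2) inS]
      continuous_on_subset[OF R(5) K(2)] by blast
  define C where "C = \<bar>C1\<bar> + C2 + C3"
  have le: "\<bar>C1\<bar> \<le> C" "C2 \<le> C" "C3 \<le> C" using C2(1) C3(1) by (auto simp: C_def)
  have ni: "norm (\<i> *s u) = norm u" for u :: "complex^'n" by (simp add: norm_vector_smult)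
  show thesis
  proof
    show "C \<ge> 0" using C2(1) C3(1) by (simp add: C_def)
    show "\<bar>R x\<bar> \<le> C" if "x \<in> K" for x using C1[OF that] le(1) by linarith
    have g: "\<bar>G x u\<bar> \<le> C * norm u" if "x \<in> K" for x u
      using C2(2)[OF that, of u] mult_right_mono[OF le(2) norm_ge_zero[of u]] by linarith
    then show "\<bar>G x u\<bar> \<le> C * norm u \<and> \<bar>G x (\<i> *s u)\<bar> \<le> C * norm u" if "x \<in> K" for x u
      using that ni by metis
    show "\<bar>H x u u + H x (\<i> *s u) (\<i> *s u)\<bar> \<le> 2 * C * (norm u)\<^sup>2" if "x \<in> K" for x u
      using C3(2)[OF that, of u u] C3(2)[OF that, of "\<i> *s u" "\<i> *s u"]
        mult_right_mono[OF le(3) zero_le_power2[of "norm u"]]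
      by (simp add: ni power2_eq_square mult.assoc)
  qed
qed

text \<open>Components away from the chart: here L = R has no singular term, so the inequality is
  used with w = 0 and yields only a bounded negative error. The added 1 in the constant secures M >=
  1.\<close>

lemma weight_estimate_off:
  fixes R :: "complex^'n::finite \<Rightarrow> real"
  assumes R: "hess_on S R G H" "open S" "continuous_on S R" "\<And>v. continuous_on S (\<lambda>x. G x v)"
      "\<And>v u. continuous_on S (\<lambda>x. H x v u)"
    and K: "compact K" "K \<subseteq> S"
  shows "\<exists>M\<ge>1. \<exists>G' H'. hess_on {x\<in>S. R x > 0} (\<lambda>x. - ln (R x)) G' H' \<and>
    (\<forall>x\<in>K. R x \<ge> 1 \<longrightarrow> (\<forall>u. H' x u u + H' x (\<i> *s u) (\<i> *s u) \<ge> - (M * (norm u)\<^sup>2)))"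
proof -
  obtain C where C: "C \<ge> 0" "\<And>x u. x \<in> K \<Longrightarrow> \<bar>G x u\<bar> \<le> C * norm u \<and> \<bar>G x (\<i> *s u)\<bar> \<le> C * norm u"
    "\<And>x u. x \<in> K \<Longrightarrow> \<bar>H x u u + H x (\<i> *s u) (\<i> *s u)\<bar> \<le> 2 * C * (norm u)\<^sup>2"
    using hess_bounds[OF R K] by metis
  let ?H = "\<lambda>x v u. - (H x v u / R x - G x v * G x u / (R x)\<^sup>2)"
  have "hess_on {x\<in>S. R x > 0} (\<lambda>x. - ln (R x)) (\<lambda>x v. - (G x v / R x)) ?H"
    by (rule hess_on_minus_ln[OF hess_on_subset[OF R(1)]]) auto
  moreover have "?H x u u + ?H x (\<i> *s u) (\<i> *s u) \<ge> - ((2 * C + 2 * C\<^sup>2 + 1) * (norm u)\<^sup>2)"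
    if "x \<in> K" "R x \<ge> 1" for x u
  proof -
    from weight_ineq[OF that(2) C(1) conjunct1[OF C(2)[OF that(1)]] conjunct2[OF C(2)[OF that(1)]] C(3)[OF that(1)], of 0]
    have "- ((2 * C + 2 * C\<^sup>2) * (norm u)\<^sup>2) \<le> ?H x u u + ?H x (\<i> *s u) (\<i> *s u)"
      by (simp add: add_divide_distrib power2_eq_square algebra_simps)
    moreover have "(2 * C + 2 * C\<^sup>2) * (norm u)\<^sup>2 \<le> (2 * C + 2 * C\<^sup>2 + 1) * (norm u)\<^sup>2"
      by (rule mult_right_mono) auto
    ultimately show ?thesis by linarith
  qed
  moreover have "2 * C + 2 * C\<^sup>2 + 1 \<ge> 1" using C(1) by simp
  ultimately show ?thesis by blast
qed

text \<open>Write l for ln |x_j|^-1, so that L = R + 2 l. From l > 1 one gets L <= (C + 2) l, which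
  turns |w|^2 / L^2 into a multiple of |d zeta_j|^2; from L >= 1 one gets 2 l <= (1 + C) L, which
  later compares ln l with ln L.\<close>

lemma weight_estimate_on:
  fixes R :: "complex^'n::finite \<Rightarrow> real"
  assumes R: "hess_on S R G H" "open S" "continuous_on S R" "\<And>v. continuous_on S (\<lambda>x. G x v)"
      "\<And>v u. continuous_on S (\<lambda>x. H x v u)"
    and K: "compact K" "K \<subseteq> S" and j: "j \<in> J"
  defines "L \<equiv> \<lambda>x. R x - ln ((cmod (x $ j))\<^sup>2)"
  shows "\<exists>M\<ge>1. \<exists>G' H'. hess_on {x\<in>S. x $ j \<noteq> 0 \<and> L x > 0} (\<lambda>x. - ln (L x)) G' H' \<and>
    (\<forall>x\<in>K. x $ j \<noteq> 0 \<and> cmod (x $ j) < 1 / exp 1 \<and> L x \<ge> 1 \<longrightarrow>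
       (\<forall>u. H' x u u + H' x (\<i> *s u) (\<i> *s u) \<ge> (cmod (dzeta J x j u))\<^sup>2 / M - M * (norm u)\<^sup>2) \<and>
       ln (inverse (cmod (x $ j))) \<le> M * L x)"
proof -
  obtain C where C: "C \<ge> 0" "\<And>x. x \<in> K \<Longrightarrow> \<bar>R x\<bar> \<le> C"
    "\<And>x u. x \<in> K \<Longrightarrow> \<bar>G x u\<bar> \<le> C * norm u \<and> \<bar>G x (\<i> *s u)\<bar> \<le> C * norm u"
    "\<And>x u. x \<in> K \<Longrightarrow> \<bar>H x u u + H x (\<i> *s u) (\<i> *s u)\<bar> \<le> 2 * C * (norm u)\<^sup>2"
    using hess_bounds[OF R K] by metis
  define GL where "GL = (\<lambda>x v. G x v - 2 * Re (v $ j / x $ j))"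
  define HL where "HL = (\<lambda>x v u. H x v u - - 2 * Re (v $ j * u $ j / (x $ j)\<^sup>2))"
  have L: "hess_on {x\<in>S. x $ j \<noteq> 0} L GL HL"
    unfolding L_def GL_def HL_def
    by (intro hess_on_diff hess_on_subset[OF R(1)] hess_on_subset[OF hess_on_ln_norm_coordinate]) auto
  let ?H = "\<lambda>x v u. - (HL x v u / L x - GL x v * GL x u / (L x)\<^sup>2)"
  have hs: "hess_on {x\<in>S. x $ j \<noteq> 0 \<and> L x > 0} (\<lambda>x. - ln (L x)) (\<lambda>x v. - (GL x v / L x)) ?H"
    by (rule hess_on_minus_ln[OF hess_on_subset[OF L]]) auto
  \<comment> \<open>M has to dominate (C + 2)^2 from the comparison of L with l, 2 C + 2 C^2 from
    \<open>weight_ineq\<close>, and 1 + C from the reverse comparison.\<close>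
  define M where "M = (C + 2)\<^sup>2 + 2 * C + 2 * C\<^sup>2"
  have M: "M \<ge> 1" "2 * C + 2 * C\<^sup>2 \<le> M" "(C + 2)\<^sup>2 \<le> M" "1 + C \<le> M"
    using C(1) by (auto simp: M_def power2_eq_square algebra_simps)
  have "?H x u u + ?H x (\<i> *s u) (\<i> *s u) \<ge> (cmod (dzeta J x j u))\<^sup>2 / M - M * (norm u)\<^sup>2"
    and "ln (inverse (cmod (x $ j))) \<le> M * L x"
    if x: "x \<in> K" "x $ j \<noteq> 0" "cmod (x $ j) < 1 / exp 1" "L x \<ge> 1" for x u
  proof -
    define l where "l = ln (inverse (cmod (x $ j)))"
    have "exp 1 < inverse (cmod (x $ j))"
      using x(2,3) by (simp add: field_simps)
    then have l: "l > 1" unfolding l_def using x(2)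
      by (metis exp_gt_zero ln_exp ln_less_cancel_iff order_less_trans)
    have Ll: "L x = R x + 2 * l"
      using x(2) by (simp add: L_def l_def ln_inverse ln_realpow)
    have CL: "C \<le> C * L x" using mult_left_mono[OF x(4) C(1)] by simp
    have "2 * l \<le> L x + C" using Ll C(2)[OF x(1)] by linarith
    also have "\<dots> \<le> (1 + C) * L x" using CL by (simp add: algebra_simps)
    also have "\<dots> \<le> M * L x" using M(4) x(4) by (intro mult_right_mono) auto
    finally show "ln (inverse (cmod (x $ j))) \<le> M * L x" using l by (simp add: l_def)
    have "C \<le> C * l" using mult_left_mono[OF less_imp_le[OF l] C(1)] by simp
    then have "L x \<le> (C + 2) * l" using Ll C(2)[OF x(1)] by (simp add: algebra_simps)
    then have "(L x)\<^sup>2 \<le> (C + 2)\<^sup>2 * l\<^sup>2"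
      using power_mono[of "L x" "(C + 2) * l" 2] x(4) by (simp add: power_mult_distrib)
    also have "\<dots> \<le> M * l\<^sup>2" using M(3) by (intro mult_right_mono) auto
    finally have L2: "(L x)\<^sup>2 \<le> M * l\<^sup>2" .
    define w where "w = u $ j / x $ j"
    have "(cmod (dzeta J x j u))\<^sup>2 / M = (cmod w)\<^sup>2 / (M * l\<^sup>2)"
      using j by (simp add: dzeta_def w_def l_def norm_divide norm_mult power_divide power_mult_distrib)
    also have "\<dots> \<le> (cmod w)\<^sup>2 / (L x)\<^sup>2"
      using L2 x(4) by (intro divide_left_mono) (auto intro!: mult_pos_pos simp: zero_less_power2 M(1) less_le_trans[OF zero_less_one M(1)])
    also have "\<dots> \<le> 2 * (cmod w)\<^sup>2 / (L x)\<^sup>2" by (simp add: divide_right_mono)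
    finally have 1: "(cmod (dzeta J x j u))\<^sup>2 / M \<le> 2 * (cmod w)\<^sup>2 / (L x)\<^sup>2" .
    have GLu: "GL x u = G x u - 2 * Re w" "GL x (\<i> *s u) = G x (\<i> *s u) - 2 * Re (\<i> * w)"
      by (simp_all add: GL_def w_def)
    have HLu: "HL x u u + HL x (\<i> *s u) (\<i> *s u) = H x u u + H x (\<i> *s u) (\<i> *s u)"
      by (simp add: HL_def mult_ac)
    have "?H x u u + ?H x (\<i> *s u) (\<i> *s u) =
      ((GL x u)\<^sup>2 + (GL x (\<i> *s u))\<^sup>2) / (L x)\<^sup>2 - (HL x u u + HL x (\<i> *s u) (\<i> *s u)) / L x"
      by (simp add: add_divide_distrib power2_eq_square)
    also have "\<dots> \<ge> 2 * (cmod w)\<^sup>2 / (L x)\<^sup>2 - (2 * C + 2 * C\<^sup>2) * (norm u)\<^sup>2"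
      unfolding GLu HLu
      by (rule weight_ineq[OF x(4) C(1) conjunct1[OF C(3)[OF x(1)]] conjunct2[OF C(3)[OF x(1)]] C(4)[OF x(1)]])
    finally have "?H x u u + ?H x (\<i> *s u) (\<i> *s u) \<ge> 2 * (cmod w)\<^sup>2 / (L x)\<^sup>2 - (2 * C + 2 * C\<^sup>2) * (norm u)\<^sup>2" .
    moreover have "(2 * C + 2 * C\<^sup>2) * (norm u)\<^sup>2 \<le> M * (norm u)\<^sup>2"
      using M(2) by (rule mult_right_mono) simp
    ultimately show "?H x u u + ?H x (\<i> *s u) (\<i> *s u) \<ge> (cmod (dzeta J x j u))\<^sup>2 / M - M * (norm u)\<^sup>2"
      using 1 by linarith
  qed
  with hs M(1) show ?thesis by blast
qed

section \<open>Comparison with the metric form and with the coframe\<close>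

text \<open>c is the minimum over K times the unit sphere, positive because it is attained;
  homogeneity of degree 2 extends the bound to all u.\<close>

lemma pos_form_bound:
  fixes atl :: "('x::t2_space, 'n::finite) chart set"
  assumes tf: "two_form atl UNIV \<omega>" and sf: "smooth_form atl UNIV \<omega>" and pf: "pos_form atl UNIV \<omega>"
    and V: "(V, z) \<in> atl" and K: "compact K" "K \<subseteq> z ` V"
  obtains c where "c > 0" "\<And>x u. x \<in> K \<Longrightarrow> Re (\<omega> (V, z) (inv_into V z x) u (\<i> *s u)) \<ge> c * (norm u)\<^sup>2"
proof (cases "K = {}")
  case True
  then show thesis using that[of 1] by auto
next
  case False
  define B where "B = (\<lambda>x u v. Re (\<omega> (V, z) (inv_into V z x) u v))"
  have inV: "inv_into V z x \<in> V" if "x \<in> K" for x using that K(2) by (auto intro: inv_into_into)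
  have bil: "bilinear (\<omega> (V, z) (inv_into V z x))" if "x \<in> K" for x
    using tf V inV[OF that] by (force simp: two_form_def)
  \<comment> \<open>Smoothness of the form gives continuity in x for fixed vectors only; the
    expansion in basis vectors yields joint continuity in (x, u).\<close>
  have rep: "B x u v = (\<Sum>b\<in>Basis. \<Sum>b'\<in>Basis. (u \<bullet> b) * (v \<bullet> b') * B x b b')" if x: "x \<in> K" for x u v
  proof -
    have "\<omega> (V, z) (inv_into V z x) u v = \<omega> (V, z) (inv_into V z x) (\<Sum>b\<in>Basis. (u \<bullet> b) *\<^sub>R b) (\<Sum>b'\<in>Basis. (v \<bullet> b') *\<^sub>R b')"
      by (simp add: euclidean_representation)
    also have "\<dots> = (\<Sum>(b,b')\<in>Basis \<times> Basis. \<omega> (V, z) (inv_into V z x) ((u \<bullet> b) *\<^sub>R b) ((v \<bullet> b') *\<^sub>R b'))"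
      by (rule bilinear_sum[OF bil[OF x]])
    also have "\<dots> = (\<Sum>(b,b')\<in>Basis \<times> Basis. ((u \<bullet> b) * (v \<bullet> b')) *\<^sub>R \<omega> (V, z) (inv_into V z x) b b')"
      by (simp add: bilinear_lmul[OF bil[OF x]] bilinear_rmul[OF bil[OF x]] mult_ac)
    finally show ?thesis by (simp add: B_def sum.cartesian_product case_prod_beta)
  qed
  have cB: "continuous_on K (\<lambda>x. B x u v)" for u v
  proof -
    have "Cinf_on (z ` (V \<inter> UNIV)) (\<lambda>x. \<omega> (V, z) (inv_into V z x) u v)"
      using sf V unfolding smooth_form_def by blast
    then have "Ck_on 0 (z ` V) (\<lambda>x. \<omega> (V, z) (inv_into V z x) u v)"
      unfolding Cinf_on_def by simp
    then show ?thesis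
      unfolding B_def using K(2) by (auto intro!: continuous_intros intro: continuous_on_subset)
  qed
  have ci: "continuous_on UNIV (\<lambda>u::complex^'n. \<i> *s u)" by (intro continuous_intros)
  have cont: "continuous_on (K \<times> sphere 0 1) (\<lambda>p. B (fst p) (snd p) (\<i> *s snd p))"
  proof -
    have "continuous_on (K \<times> sphere 0 1) (\<lambda>p. \<Sum>b\<in>Basis. \<Sum>b'\<in>Basis. (snd p \<bullet> b) * ((\<i> *s snd p) \<bullet> b') * B (fst p) b b')"
      by (intro continuous_intros continuous_on_compose2[OF cB] ) auto
    then show ?thesis
      by (rule continuous_on_eq) (auto simp: rep)
  qed
  have "sphere (0::complex^'n) 1 \<noteq> {}" by simp
  then have ne: "K \<times> sphere (0::complex^'n) 1 \<noteq> {}" using False by blast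
  obtain p where p: "p \<in> K \<times> sphere 0 1"
    "\<And>q. q \<in> K \<times> sphere 0 1 \<Longrightarrow> B (fst p) (snd p) (\<i> *s snd p) \<le> B (fst q) (snd q) (\<i> *s snd q)"
    using continuous_attains_inf[OF compact_Times[OF K(1) compact_sphere] ne cont] by blast
  define c where "c = B (fst p) (snd p) (\<i> *s snd p)"
  show thesis
  proof
    have "snd p \<noteq> 0" "fst p \<in> K" using p(1) by auto
    then show "c > 0"
      using pf V inV[of "fst p"] unfolding pos_form_def c_def B_def by force
    fix x and u :: "complex^'n" assume x: "x \<in> K"
    show "Re (\<omega> (V, z) (inv_into V z x) u (\<i> *s u)) \<ge> c * (norm u)\<^sup>2"
    proof (cases "u = 0")
      case True
      then show ?thesis using bilinear_lzero[OF bil[OF x]] by simp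
    next
      case False
      define e where "e = (1 / norm u) *\<^sub>R u"
      have e: "norm e = 1" "u = norm u *\<^sub>R e" using False by (auto simp: e_def)
      have ie: "\<i> *s u = norm u *\<^sub>R (\<i> *s e)"
        unfolding e_def using False by (simp add: vec_eq_iff)
      have "Re (\<omega> (V, z) (inv_into V z x) u (\<i> *s u)) = (norm u)\<^sup>2 * B x e (\<i> *s e)"
        unfolding ie by (subst e(2)) (simp add: bilinear_lmul[OF bil[OF x]] bilinear_rmul[OF bil[OF x]] B_def power2_eq_square)
      moreover have "c \<le> B x e (\<i> *s e)"
        using p(2)[of "(x, e)"] x e(1) by (simp add: c_def)
      ultimately show ?thesis by (simp add: mult.commute[of c] mult_left_mono)
    qed
  qed
qed

text \<open>Replacing u by iu leaves the modulus of every covector of the coframe unchanged, so both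
  terms of the wedge are products s t, bounded by the arithmetic-geometric mean inequality.\<close>

lemma coframe_bounds:
  fixes u a :: "complex^'n::finite"
  shows "cmod (wedge (coframe S a b) (coframe S a b') u (\<i> *s u)) \<le> 2 * (\<Sum>k\<in>UNIV. (cmod (dzeta S a k u))\<^sup>2)"
proof -
  define Z where "Z = (\<Sum>k\<in>UNIV. (cmod (dzeta S a k u))\<^sup>2)"
  have ci: "cmod (coframe S a b (\<i> *s u)) = cmod (coframe S a b u)" for b
    by (cases b) (auto simp: coframe_def dzeta_def norm_mult norm_divide)
  have "(cmod (dzeta S a k u))\<^sup>2 \<le> Z" for k
    unfolding Z_def by (rule member_le_sum) auto
  then have cZ: "(cmod (coframe S a b u))\<^sup>2 \<le> Z" for b
    by (cases b) (auto simp: coframe_def)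
  define s t where "s = cmod (coframe S a b u)" and "t = cmod (coframe S a b' u)"
  have "2 * (s * t) \<le> s\<^sup>2 + t\<^sup>2" using zero_le_power2[of "s - t"] by (simp add: power2_eq_square algebra_simps)
  then have st: "s * t \<le> Z" using cZ[of b] cZ[of b'] by (simp add: s_def t_def)
  have "cmod (wedge (coframe S a b) (coframe S a b') u (\<i> *s u)) \<le> s * t + s * t"
    unfolding wedge_def by (rule order_trans[OF norm_triangle_ineq4]) (simp add: norm_mult ci s_def t_def)
  then show ?thesis using st by (simp add: Z_def)
qed

text \<open>The weights produce d zeta_k only for k in S; the remaining ones are plain coordinate
  differentials, to be paid for by \<open>\<omega>\<close>.\<close>

lemma dzeta_sum_le:
  fixes u a :: "complex^'n::finite"
  shows "(\<Sum>k\<in>UNIV. (cmod (dzeta S a k u))\<^sup>2) \<le> (\<Sum>k\<in>S. (cmod (dzeta S a k u))\<^sup>2) + (norm u)\<^sup>2"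
proof -
  have "(\<Sum>k\<in>UNIV. (cmod (dzeta S a k u))\<^sup>2) = (\<Sum>k\<in>S. (cmod (dzeta S a k u))\<^sup>2) + (\<Sum>k\<in>-S. (cmod (dzeta S a k u))\<^sup>2)"
    by (subst sum.union_disjoint[symmetric]) auto
  moreover have "(\<Sum>k\<in>-S. (cmod (dzeta S a k u))\<^sup>2) = (\<Sum>k\<in>-S. (cmod (u $ k))\<^sup>2)"
    by (rule sum.cong) (auto simp: dzeta_def)
  moreover have "\<dots> \<le> (\<Sum>k\<in>UNIV. (cmod (u $ k))\<^sup>2)"
    by (rule sum_mono2) auto
  moreover have "\<dots> = (norm u)\<^sup>2"
    by (simp add: norm_vec_def L2_set_def sum_nonneg)
  ultimately show ?thesis by linarith
qed

section \<open>Adapted charts with uniform estimates around a point\<close>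

lemma snc_adapted_chart:
  fixes atl :: "('x::t2_space, 'n::finite) chart set"
  assumes cs: "complex_structure atl" and snc: "snc_divisor atl m D"
  defines "I \<equiv> \<lambda>p. {k\<in>{1..m}. p \<in> D k}"
  obtains V z j where "p0 \<in> V" "adapted_chart atl (\<Union>k\<in>{1..m}. D k) (V, z) (j ` I p0)" "inj_on j (I p0)"
    "\<And>k q. k \<in> I p0 \<Longrightarrow> q \<in> V \<Longrightarrow> z q $ j k = 0 \<longleftrightarrow> q \<in> D k"
    "\<And>k. k \<in> {1..m} - I p0 \<Longrightarrow> V \<inter> D k = {}"
proof -
  have "\<exists>(V, z)\<in>atl. p0 \<in> V \<and> (\<exists>j. inj_on j (I p0) \<and>
      (\<forall>k\<in>{1..m}. D k \<inter> V = (if p0 \<in> D k then {q\<in>V. z q $ j k = 0} else {})))"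
    using snc unfolding snc_divisor_def I_def by blast
  then obtain V0 z0 j where V0: "(V0, z0) \<in> atl" "p0 \<in> V0" and j: "inj_on j (I p0)"
    and D: "\<And>k. k \<in> {1..m} \<Longrightarrow> D k \<inter> V0 = (if p0 \<in> D k then {q\<in>V0. z0 q $ j k = 0} else {})"
    by blast
  note ch = atlas_chart[OF cs V0(1)]
  define U where "U = V0 \<inter> z0 -` ball (z0 p0) (1 / exp 1)"
  have U: "open U"
    unfolding U_def by (rule continuous_open_preimage[OF chart_continuous[OF ch] chart_open[OF ch] open_ball])
  define z where "z = (\<lambda>p. z0 p - z0 p0)"
  have in_atl: "(V0 \<inter> U, z) \<in> atl"
    unfolding z_def by (rule chart_restrict_translate[OF cs V0(1) U])
  have V: "V0 \<inter> U = U" by (auto simp: U_def)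
  have z: "z q $ j k = 0 \<longleftrightarrow> q \<in> D k" if "k \<in> I p0" "q \<in> U" for k q
  proof -
    have k: "k \<in> {1..m}" "p0 \<in> D k" using that(1) by (auto simp: I_def)
    then have eq: "q \<in> D k \<longleftrightarrow> z0 q $ j k = 0" if "q \<in> V0" for q using D[of k] that by auto
    \<comment> \<open>The components through p0 keep their equations because the translation
      subtracts 0 in their coordinates.\<close>
    have "z0 p0 $ j k = 0" using eq[OF V0(2)] k by simp
    then show ?thesis using eq[of q] that(2) by (simp add: z_def U_def)
  qed
  have off: "U \<inter> D k = {}" if "k \<in> {1..m} - I p0" for k
    using D[of k] that by (auto simp: I_def U_def)
  show thesis
  proof (rule that[OF _ _ j z off])
    show "p0 \<in> U" using V0(2) by (simp add: U_def)
    have "cmod (z p $ i) < 1 / exp 1" if "p \<in> U" for p i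
    proof -
      have "norm (z p) < 1 / exp 1" using that by (simp add: U_def z_def dist_norm norm_minus_commute)
      then show ?thesis using Finite_Cartesian_Product.norm_nth_le[of "z p" i] by linarith
    qed
    moreover have "(\<Union>k\<in>{1..m}. D k) \<inter> U = {p \<in> U. (\<Prod>k\<in>j ` I p0. z p $ k) = 0}"
    proof (rule set_eqI)
      fix q
      have "(\<exists>k\<in>{1..m}. q \<in> D k) \<longleftrightarrow> (\<exists>k\<in>I p0. z q $ j k = 0)" if q: "q \<in> U"
        using z[OF _ q] off q by (auto simp: I_def) blast+
      moreover have "finite (j ` I p0)" by (simp add: I_def)
      ultimately show "q \<in> (\<Union>k\<in>{1..m}. D k) \<inter> U \<longleftrightarrow> q \<in> {p \<in> U. (\<Prod>k\<in>j ` I p0. z p $ k) = 0}"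
        by auto
    qed
    ultimately show "adapted_chart atl (\<Union>k\<in>{1..m}. D k) (U, z) (j ` I p0)"
      using in_atl unfolding adapted_chart_def V by auto
  qed
qed

text \<open>This is what the bound exp(-e) on the norms is for: L >= 1 in the Hessian estimates, and
  powers of ln L that increase with the exponent.\<close>

lemma ln_ln_inverse_ge_1:
  assumes "0 < r" "r \<le> exp (- exp 1 :: real)"
  shows "ln (inverse r) \<ge> exp 1" "ln (ln (inverse r)) \<ge> 1"
proof -
  have "ln r \<le> - exp 1" using assms by (metis ln_exp ln_le_cancel_iff exp_gt_zero)
  then show 1: "ln (inverse r) \<ge> exp 1" using assms(1) by (simp add: ln_inverse)
  have "0 < ln (inverse r)" using 1 exp_gt_zero[of "1::real"] by linarith
  then show "ln (ln (inverse r)) \<ge> 1" using 1 by (metis ln_exp ln_le_cancel_iff exp_gt_zero)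
qed

text \<open>Collects everything about the geometry near p0, before \<open>\<eta>\<close> enters.
  Each component contributes its own estimate, and these are summed; components through p0 supply
  the d zeta_k, one for each k in S because j is injective on them.\<close>

lemma local_frame:
  fixes atl :: "('x::t2_space, 'n::finite) chart set"
  assumes comp: "compact (UNIV :: 'x set)" and cs: "complex_structure atl"
    and snc: "snc_divisor atl m D"
    and gs: "\<And>k. k \<in> {1..m} \<Longrightarrow> global_section atl (D k) (s k)"
    and dv: "\<And>k. k \<in> {1..m} \<Longrightarrow> div_eq atl (D k) (s k)"
    and hm: "\<And>k. k \<in> {1..m} \<Longrightarrow> hermitian_metric atl (D k) (h k)"
    and small: "\<And>k p. k \<in> {1..m} \<Longrightarrow> norm_sq atl (D k) (h k) (s k) p \<le> exp (- exp 1)"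
    and om: "two_form atl UNIV \<omega>" "smooth_form atl UNIV \<omega>" "pos_form atl UNIV \<omega>"
  defines "DD \<equiv> (\<Union>k\<in>{1..m}. D k)" and "nsq \<equiv> \<lambda>k. norm_sq atl (D k) (h k) (s k)"
  obtains V z S W M c T F G H where "adapted_chart atl DD (V, z) S" "p0 \<in> W" "open W"
    "compact (closure W)" "closure W \<subseteq> V" "M \<ge> 1" "c > 0"
    "open T" "z ` (V - DD) \<subseteq> T" "hess_on T F G H"
    "\<And>x. x \<in> T \<Longrightarrow> - Theta m nsq 1 (inv_into V z x) = F x"
    "\<And>p u. p \<in> W - DD \<Longrightarrow> H (z p) u u + H (z p) (\<i> *s u) (\<i> *s u) \<ge>
        (\<Sum>k\<in>S. (cmod (dzeta S (z p) k u))\<^sup>2) / M - M * (norm u)\<^sup>2"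
    "\<And>p u. p \<in> W \<Longrightarrow> Re (\<omega> (V, z) p u (\<i> *s u)) \<ge> c * (norm u)\<^sup>2"
    "\<And>k. k \<in> S \<Longrightarrow> \<exists>k'\<in>{1..m}. \<forall>p\<in>W - DD. ln (inverse (cmod (z p $ k))) \<le> M * ln (inverse (nsq k' p))"
    "\<And>k p. k \<in> {1..m} \<Longrightarrow> p \<in> V - DD \<Longrightarrow> nsq k p > 0"
proof -
  define I where "I = {k\<in>{1..m}. p0 \<in> D k}"
  obtain V z j where p0: "p0 \<in> V" and ad: "adapted_chart atl DD (V, z) (j ` I)" and j: "inj_on j I"
    and on: "\<And>k q. k \<in> I \<Longrightarrow> q \<in> V \<Longrightarrow> z q $ j k = 0 \<longleftrightarrow> q \<in> D k"
    and off: "\<And>k. k \<in> {1..m} - I \<Longrightarrow> V \<inter> D k = {}"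
    by (rule snc_adapted_chart[OF cs snc, of p0, folded I_def DD_def]) blast
  have V: "(V, z) \<in> atl" and lt: "\<And>p i. p \<in> V \<Longrightarrow> cmod (z p $ i) < 1 / exp 1"
    using ad by (auto simp: adapted_chart_def)
  note ch = atlas_chart[OF cs V]
  have oV: "open (z ` V)" using chart_open_image[OF ch open_UNIV] by simp
  define S where "S = j ` I"
  have finI: "finite I" by (simp add: I_def)
  obtain r where r: "r > 0" "cball (z p0) r \<subseteq> z ` V"
    using oV p0 open_contains_cball by blast
  define K where "K = cball (z p0) r"
  have K: "compact K" "K \<subseteq> z ` V" using r by (auto simp: K_def)
  \<comment> \<open>The closure of W lies in the preimage of the closed ball K, a compact and hence
    closed set in the Hausdorff manifold, so it stays inside V.\<close>
  define W where "W = V \<inter> z -` ball (z p0) r"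
  have oW: "open W"
    unfolding W_def by (rule continuous_open_preimage[OF chart_continuous[OF ch] chart_open[OF ch] open_ball])
  have p0W: "p0 \<in> W" using p0 r by (simp add: W_def)
  have zW: "z p \<in> K" "p \<in> V" if "p \<in> W" for p using that by (auto simp: W_def K_def)
  have cK: "compact (inv_into V z ` K)"
    by (rule compact_continuous_image[OF continuous_on_subset[OF chart_continuous_inv[OF ch] K(2)] K(1)])
  have "W \<subseteq> inv_into V z ` K"
    using zW chart_inv[OF ch] by (metis imageI subsetI)
  then have "closure W \<subseteq> inv_into V z ` K"
    by (rule closure_minimal) (rule compact_imp_closed[OF cK])
  also have "\<dots> \<subseteq> V" using K(2) by (auto intro!: inv_into_into)
  finally have clW: "closure W \<subseteq> V" .
  have ccW: "compact (closure W)" using compact_Int_closed[OF comp, of "closure W"] by simp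
  \<comment> \<open>The coordinate image of V - DD, since only components with index in I meet V.
    All the functions - ln L_k are twice differentiable there.\<close>
  define T where "T = z ` V \<inter> {x. \<forall>k\<in>I. x $ j k \<noteq> 0}"
  have oT: "open T"
  proof -
    have "open {x::complex^'n. x $ i \<noteq> 0}" for i
      by (rule open_Collect_neq) (intro continuous_intros)+
    then have "open (\<Inter>k\<in>I. {x::complex^'n. x $ j k \<noteq> 0})"
      using finI by blast
    moreover have "(\<Inter>k\<in>I. {x::complex^'n. x $ j k \<noteq> 0}) = {x. \<forall>k\<in>I. x $ j k \<noteq> 0}" by auto
    ultimately show ?thesis unfolding T_def using oV by (simp add: open_Int)
  qed
  have T: "x \<in> T \<longleftrightarrow> inv_into V z x \<in> V - DD" if "x \<in> z ` V" for x
  proof -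
    have q: "inv_into V z x \<in> V" "z (inv_into V z x) = x"
      using that by (auto intro: inv_into_into f_inv_into_f)
    have "I \<subseteq> {1..m}" by (auto simp: I_def)
    moreover have "inv_into V z x \<notin> D k" if "k \<in> {1..m} - I" for k
      using off[OF that] q(1) by blast
    ultimately have "inv_into V z x \<in> DD \<longleftrightarrow> (\<exists>k\<in>I. inv_into V z x \<in> D k)"
      unfolding DD_def by blast
    then show ?thesis
      using that q on[OF _ q(1)] by (auto simp: T_def)
  qed
  have TV: "T \<subseteq> z ` V" by (auto simp: T_def)
  have zT: "z ` (V - DD) \<subseteq> T"
    using T chart_inv[OF ch] by auto
  define L where "L = (\<lambda>k p. ln (inverse (nsq k p)))"
  \<comment> \<open>The facts about a single component as one predicate, so that the constants and
    derivatives can be chosen for all k simultaneously.\<close>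
  define P where "P = (\<lambda>k (M::real) F G H. M \<ge> 1 \<and> hess_on T F G H \<and> (\<forall>q\<in>V - DD. nsq k q > 0) \<and> (\<forall>q\<in>V - DD. - ln (L k q) = F (z q)) \<and>
      (\<forall>q\<in>W - DD. (\<forall>u. H (z q) u u + H (z q) (\<i> *s u) (\<i> *s u) \<ge>
           (if k \<in> I then (cmod (dzeta S (z q) (j k) u))\<^sup>2 / M else 0) - M * (norm u)\<^sup>2) \<and>
         (k \<in> I \<longrightarrow> ln (inverse (cmod (z q $ j k))) \<le> M * L k q)))"
  have "\<exists>M F G H. P k M F G H"
    if k: "k \<in> {1..m}" for k
  proof -
    have notD: "q \<in> V - D k" if "q \<in> V - DD" for q using that k by (auto simp: DD_def)
    have L1: "L k q \<ge> 1" if "norm_sq atl (D k) (h k) (s k) q > 0" for q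
      using order_trans[OF one_le_exp_iff[THEN iffD2, OF zero_le_one] ln_ln_inverse_ge_1(1)[OF that small[OF k]]]
      by (simp add: L_def nsq_def)
    show ?thesis
    proof (cases "k \<in> I")
      case True
      have le: "(V, \<lambda>p. z p $ j k) \<in> local_equations atl (D k)"
        by (rule coordinate_local_equation[OF cs V on[OF True]])
      obtain R G H where R: "hess_on (z ` V) R G H" "continuous_on (z ` V) R"
        "\<And>v. continuous_on (z ` V) (\<lambda>x. G x v)" "\<And>v u. continuous_on (z ` V) (\<lambda>x. H x v u)"
        and eq: "\<And>p. p \<in> V - D k \<Longrightarrow> nsq k p > 0 \<and> L k p = R (z p) - ln ((cmod (z p $ j k))\<^sup>2)"
        using norm_sq_log_local[OF V ch gs[OF k] dv[OF k] hm[OF k] le] unfolding nsq_def L_def by metis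
      have jk: "j k \<in> S" using True by (simp add: S_def)
      define L' where "L' = (\<lambda>x. R x - ln ((cmod (x $ j k))\<^sup>2))"
      obtain M G' H' where M: "M \<ge> 1"
        and hs: "hess_on {x\<in>z ` V. x $ j k \<noteq> 0 \<and> L' x > 0} (\<lambda>x. - ln (L' x)) G' H'"
        and est: "\<And>x. x \<in> K \<Longrightarrow> x $ j k \<noteq> 0 \<Longrightarrow> cmod (x $ j k) < 1 / exp 1 \<Longrightarrow> L' x \<ge> 1 \<Longrightarrow>
          (\<forall>u. H' x u u + H' x (\<i> *s u) (\<i> *s u) \<ge> (cmod (dzeta S x (j k) u))\<^sup>2 / M - M * (norm u)\<^sup>2) \<and>
          ln (inverse (cmod (x $ j k))) \<le> M * L' x"
        using weight_estimate_on[OF R(1) oV R(2-4) K jk] unfolding L'_def by blast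
      have L': "L' (z q) = L k q" "L k q \<ge> 1" "z q $ j k \<noteq> 0" if "q \<in> V - DD" for q
        using eq[OF notD[OF that]] L1[of q] on[OF True, of q] notD[OF that] 
        by (auto simp: L'_def nsq_def)
      have "hess_on T (\<lambda>x. - ln (L' x)) G' H'"
      proof (rule hess_on_subset[OF hs], rule)
        fix x assume x: "x \<in> T"
        then have xV: "x \<in> z ` V" using TV by blast
        have "z (inv_into V z x) = x" using xV by (rule f_inv_into_f)
        with L'[OF T[OF xV, THEN iffD1, OF x]] xV
        show "x \<in> {x\<in>z ` V. x $ j k \<noteq> 0 \<and> L' x > 0}"
          by simp
      qed
      moreover have "\<forall>q\<in>V - DD. nsq k q > 0" using eq notD by blast
      moreover have "\<forall>q\<in>V - DD. - ln (L k q) = - ln (L' (z q))" using L' by simp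
      moreover have "(\<forall>u. H' (z q) u u + H' (z q) (\<i> *s u) (\<i> *s u) \<ge>
           (cmod (dzeta S (z q) (j k) u))\<^sup>2 / M - M * (norm u)\<^sup>2) \<and>
         ln (inverse (cmod (z q $ j k))) \<le> M * L k q" if "q \<in> W - DD" for q
        using est[of "z q"] L'[of q] zW[of q] lt[of q] that by auto
      ultimately show ?thesis unfolding P_def using M True
        by (intro exI[of _ M] exI[of _ "\<lambda>x. - ln (L' x)"] exI[of _ G'] exI[of _ H'] conjI ballI) auto
    next
      case False
      have le: "(V, \<lambda>p. 1) \<in> local_equations atl (D k)"
        by (rule one_local_equation[OF chart_open[OF ch] off]) (use k False in auto)
      obtain R G H where R: "hess_on (z ` V) R G H" "continuous_on (z ` V) R"
        "\<And>v. continuous_on (z ` V) (\<lambda>x. G x v)" "\<And>v u. continuous_on (z ` V) (\<lambda>x. H x v u)"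
        and eq: "\<And>p. p \<in> V - D k \<Longrightarrow> nsq k p > 0 \<and> L k p = R (z p) - ln ((cmod 1)\<^sup>2)"
        using norm_sq_log_local[OF V ch gs[OF k] dv[OF k] hm[OF k] le] unfolding nsq_def L_def by metis
      obtain M G' H' where M: "M \<ge> 1"
        and hs: "hess_on {x\<in>z ` V. R x > 0} (\<lambda>x. - ln (R x)) G' H'"
        and est: "\<And>x. x \<in> K \<Longrightarrow> R x \<ge> 1 \<Longrightarrow>
          (\<forall>u. H' x u u + H' x (\<i> *s u) (\<i> *s u) \<ge> - (M * (norm u)\<^sup>2))"
        using weight_estimate_off[OF R(1) oV R(2-4) K] by blast
      have L': "R (z q) = L k q" "L k q \<ge> 1" if "q \<in> V - DD" for q
        using eq[OF notD[OF that]] L1[of q] by (auto simp: nsq_def)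
      have "hess_on T (\<lambda>x. - ln (R x)) G' H'"
      proof (rule hess_on_subset[OF hs], rule)
        fix x assume x: "x \<in> T"
        then have xV: "x \<in> z ` V" using TV by blast
        have "z (inv_into V z x) = x" using xV by (rule f_inv_into_f)
        with L'[OF T[OF xV, THEN iffD1, OF x]] xV
        show "x \<in> {x\<in>z ` V. R x > 0}"
          by simp
      qed
      moreover have "\<forall>q\<in>V - DD. nsq k q > 0" using eq notD by blast
      moreover have "\<forall>q\<in>V - DD. - ln (L k q) = - ln (R (z q))" using L' by simp
      moreover have "\<forall>u. H' (z q) u u + H' (z q) (\<i> *s u) (\<i> *s u) \<ge> - (M * (norm u)\<^sup>2)"
        if "q \<in> W - DD" for q
        using est[of "z q"] L'[of q] zW[of q] that by auto
      ultimately show ?thesis unfolding P_def using M False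
        by (intro exI[of _ M] exI[of _ "\<lambda>x. - ln (R x)"] exI[of _ G'] exI[of _ H'] conjI ballI) auto
    qed
  qed
  then obtain M F G H where P: "P k (M k) (F k) (G k) (H k)" if "k \<in> {1..m}" for k
    by metis
  have M: "\<And>k. k \<in> {1..m} \<Longrightarrow> M k \<ge> 1"
    and hs: "\<And>k. k \<in> {1..m} \<Longrightarrow> hess_on T (F k) (G k) (H k)"
    and pos: "\<And>k q. k \<in> {1..m} \<Longrightarrow> q \<in> V - DD \<Longrightarrow> nsq k q > 0"
    and F: "\<And>k q. k \<in> {1..m} \<Longrightarrow> q \<in> V - DD \<Longrightarrow> - ln (L k q) = F k (z q)"
    and est: "\<And>k q u. k \<in> {1..m} \<Longrightarrow> q \<in> W - DD \<Longrightarrow> H k (z q) u u + H k (z q) (\<i> *s u) (\<i> *s u) \<ge>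
           (if k \<in> I then (cmod (dzeta S (z q) (j k) u))\<^sup>2 / M k else 0) - M k * (norm u)\<^sup>2"
    and Lle: "\<And>k q. k \<in> I \<Longrightarrow> q \<in> W - DD \<Longrightarrow> ln (inverse (cmod (z q $ j k))) \<le> M k * L k q"
    using P unfolding P_def I_def by simp_all
  \<comment> \<open>The sum serves two purposes: it bounds each M k, which occurs as a denominator,
    and the total of the error terms. The 1 ensures M0 >= 1 even for an empty sum.\<close>
  define M0 where "M0 = 1 + (\<Sum>k\<in>{1..m}. M k)"
  have M0: "M0 \<ge> 1" "(\<Sum>k\<in>{1..m}. M k) \<le> M0"
    using M by (auto simp: M0_def intro!: sum_nonneg) (smt (verit) M atLeastAtMost_iff)
  have Mk: "M k \<le> M0" if "k \<in> {1..m}" for k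
  proof -
    have "M k \<le> (\<Sum>k\<in>{1..m}. M k)"
      using M by (intro member_le_sum that) (auto, smt (verit) M atLeastAtMost_iff)
    then show ?thesis using M0 by linarith
  qed
  obtain c where c: "c > 0" "\<And>x u. x \<in> K \<Longrightarrow> Re (\<omega> (V, z) (inv_into V z x) u (\<i> *s u)) \<ge> c * (norm u)\<^sup>2"
    using pos_form_bound[OF om V K] by metis
  show thesis
  proof (rule that[OF ad[folded S_def] p0W oW ccW clW M0(1) c(1) oT zT hess_on_sum[OF hs, of "{1..m}"]])
    fix x assume x: "x \<in> T"
    then have xV: "x \<in> z ` V" using TV by blast
    have "inv_into V z x \<in> V - DD" using T[OF xV] x by blast
    moreover have "z (inv_into V z x) = x" using xV by (rule f_inv_into_f)
    ultimately show "- Theta m nsq 1 (inv_into V z x) = (\<Sum>k\<in>{1..m}. F k x)"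
      using F[of _ "inv_into V z x"] by (simp add: Theta_def L_def sum_negf[symmetric])
  next
    fix p u assume p: "p \<in> W - DD"
    have "(\<Sum>k\<in>S. (cmod (dzeta S (z p) k u))\<^sup>2) / M0 - M0 * (norm u)\<^sup>2 \<le>
      (\<Sum>k\<in>I. (cmod (dzeta S (z p) (j k) u))\<^sup>2) / M0 - (\<Sum>k\<in>{1..m}. M k) * (norm u)\<^sup>2"
      using M0(2) by (simp add: S_def sum.reindex[OF j] mult_right_mono diff_left_mono)
    also have "\<dots> = (\<Sum>k\<in>{1..m}. (if k \<in> I then (cmod (dzeta S (z p) (j k) u))\<^sup>2 / M0 else 0) - M k * (norm u)\<^sup>2)"
    proof -
      have "(\<Sum>k\<in>{1..m}. if k \<in> I then (cmod (dzeta S (z p) (j k) u))\<^sup>2 / M0 else 0) =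
        (\<Sum>k\<in>I. (cmod (dzeta S (z p) (j k) u))\<^sup>2 / M0)"
        by (subst sum.If_cases) (auto simp: I_def intro!: sum.cong)
      then show ?thesis by (simp add: sum_subtractf sum_divide_distrib sum_distrib_right)
    qed
    also have "\<dots> \<le> (\<Sum>k\<in>{1..m}. H k (z p) u u + H k (z p) (\<i> *s u) (\<i> *s u))"
    proof (rule sum_mono)
      fix k assume k: "k \<in> {1..m}"
      have "(cmod (dzeta S (z p) (j k) u))\<^sup>2 / M0 \<le> (cmod (dzeta S (z p) (j k) u))\<^sup>2 / M k"
        using M[OF k] Mk[OF k] by (intro divide_left_mono) (auto intro!: mult_pos_pos)
      then show "(if k \<in> I then (cmod (dzeta S (z p) (j k) u))\<^sup>2 / M0 else 0) - M k * (norm u)\<^sup>2 \<le>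
        H k (z p) u u + H k (z p) (\<i> *s u) (\<i> *s u)"
        using est[OF k p, of u] by (auto split: if_splits)
    qed
    finally show "(\<Sum>k\<in>{1..m}. H k (z p) u u) + (\<Sum>k\<in>{1..m}. H k (z p) (\<i> *s u) (\<i> *s u)) \<ge>
        (\<Sum>k\<in>S. (cmod (dzeta S (z p) k u))\<^sup>2) / M0 - M0 * (norm u)\<^sup>2"
      by (simp add: sum.distrib)
  next
    fix p u assume "p \<in> W"
    then show "Re (\<omega> (V, z) p u (\<i> *s u)) \<ge> c * (norm u)\<^sup>2"
      using c(2)[of "z p" u] zW[of p] chart_inv[OF ch, of p] by simp
  next
    fix k assume "k \<in> S"
    then obtain k' where k': "k' \<in> I" "k = j k'" by (auto simp: S_def)
    then have k'm: "k' \<in> {1..m}" by (simp add: I_def)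
    have "ln (inverse (cmod (z p $ k))) \<le> M0 * ln (inverse (nsq k' p))" if p: "p \<in> W - DD" for p
    proof -
      have "0 < M k'" using M[OF k'm] by simp
      have pV: "p \<in> V" using p zW by blast
      \<comment> \<open>A coordinate of modulus below 1 makes the left side nonnegative, hence also
        L k' p, so that M k' may be enlarged to M0.\<close>
      have "cmod (z p $ k) < 1" using lt[OF pV, of k] exp_gt_one[of "1::real"]
        by (smt (verit) divide_le_eq_1 exp_gt_zero zero_less_one)
      moreover have "z p $ k \<noteq> 0" using on[OF k'(1) pV] p k'm k'(2) by (auto simp: DD_def)
      ultimately have 0: "0 \<le> ln (inverse (cmod (z p $ k)))"
        by (simp add: one_le_inverse less_imp_le)
      have "0 \<le> M k' * L k' p" using order_trans[OF 0[unfolded k'(2)] Lle[OF k'(1) p]] .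
      then have "0 \<le> L k' p" using \<open>0 < M k'\<close> by (simp add: zero_le_mult_iff)
      then have "M k' * L k' p \<le> M0 * L k' p" by (rule mult_right_mono[OF Mk[OF k'm]])
      then show ?thesis using Lle[OF k'(1) p] k'(2) by (simp add: L_def)
    qed
    then show "\<exists>k'\<in>{1..m}. \<forall>p\<in>W - DD. ln (inverse (cmod (z p $ k))) \<le> M0 * ln (inverse (nsq k' p))"
      using k'm by blast
  qed (use pos in auto)
qed

section \<open>From local to global\<close>

lemma two_form_transition:
  assumes "two_form atl U \<eta>" "(W, w) \<in> atl" "(V, z) \<in> atl" "p \<in> W" "p \<in> V" "p \<in> U"
  defines "J \<equiv> frechet_derivative (transition (W, w) (V, z)) (at (w p))"
  shows "\<eta> (W, w) p u v = \<eta> (V, z) p (J u) (J v)"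
proof -
  have "\<forall>c\<in>atl. \<forall>d\<in>atl. \<forall>p\<in>fst c \<inter> fst d \<inter> U. \<forall>u v. \<eta> c p u v =
      (let J = frechet_derivative (transition c d) (at (snd c p)) in \<eta> d p (J u) (J v))"
    using assms(1) unfolding two_form_def by (rule conjunct2)
  from bspec[OF bspec[OF bspec[OF this assms(2)] assms(3)], of p] assms(4-6) show ?thesis
    by (simp add: Let_def J_def)
qed

lemma real_11_form_real:
  assumes "real_11_form atl U \<eta>" "(V, z) \<in> atl" "p \<in> V" "p \<in> U"
  shows "\<eta> (V, z) p u v \<in> \<real>"
proof -
  have "\<forall>c\<in>atl. \<forall>p\<in>fst c \<inter> U. \<forall>u v. \<eta> c p (\<i> *s u) (\<i> *s v) = \<eta> c p u v \<and> \<eta> c p u v \<in> \<real>"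
    using assms(1) unfolding real_11_form_def by (rule conjunct2)
  from bspec[OF bspec[OF this assms(2)], of p] assms(3,4) show ?thesis by simp
qed

text \<open>Everything is pulled back to the adapted chart, with v the image of u. With Z the sum of
  all |d zeta_k (v)|^2, the weight form is at least Z / (4 pi M) and |\<open>\<eta>\<close>| is at
  most a multiple of E \<open>\<tau>\<close> Z; B is large enough to compensate. The number t takes
  the place of Theta_N and \<open>\<tau>\<close> that of the growth bound.\<close>

lemma frame_pointwise:
  fixes atl :: "('x::t2_space, 'n::finite) chart set" and f :: "'x \<Rightarrow> real"
  assumes cs: "complex_structure atl" and V: "(V, z) \<in> atl" and p: "p \<in> V" "p \<notin> D"
    and \<eta>: "real_11_form atl (- D) \<eta>" and \<omega>: "real_11_form atl UNIV \<omega>"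
    and hess: "open T" "z p \<in> T" "hess_on T F G H" "\<And>x. x \<in> T \<Longrightarrow> f (inv_into V z x) = F x"
    and lap: "\<And>u. H (z p) u u + H (z p) (\<i> *s u) (\<i> *s u) \<ge>
        (\<Sum>k\<in>S. (cmod (dzeta S (z p) k u))\<^sup>2) / M - M * (norm u)\<^sup>2"
    and pos: "\<And>u. Re (\<omega> (V, z) p u (\<i> *s u)) \<ge> c * (norm u)\<^sup>2"
    and coeff: "coefficients atl D \<eta> (V, z) S g" and g: "\<And>a b. cmod (g a b p) \<le> E * \<tau>"
    and const: "M \<ge> 1" "0 \<le> E" "0 \<le> \<tau>" "\<tau> \<le> t" "A \<ge> 0" "A * c \<ge> (1 / M + M) / (4 * pi)"
      "B \<ge> 2 * (real CARD('n + 'n))\<^sup>2 * E * (4 * pi * M)"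
    and W: "(W, w) \<in> atl" "p \<in> W"
  defines "e \<equiv> \<lambda>u. \<eta> (W, w) p u (\<i> *s u) +
    of_real (B * t) * (ddc f (W, w) p u (\<i> *s u) + of_real A * \<omega> (W, w) p u (\<i> *s u))"
  shows "e u \<in> \<real> \<and> Re (e u) \<ge> 0"
proof -
  define v where "v = frechet_derivative (transition (W, w) (V, z)) (at (w p)) u"
  note tr = ddc_transition[where f = f and u = u, OF cs W(1) V W(2) p(1) hess(3,1,2,4), folded v_def]
  have pull: "\<eta> (W, w) p u (\<i> *s u) = \<eta> (V, z) p v (\<i> *s v)" "\<omega> (W, w) p u (\<i> *s u) = \<omega> (V, z) p v (\<i> *s v)"
    using two_form_transition[OF _ W(1) V W(2) p(1), of _ \<eta> u "\<i> *s u"]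
      two_form_transition[OF _ W(1) V W(2) p(1), of _ \<omega> u "\<i> *s u"] \<eta> \<omega> p tr(2)
    by (auto simp: real_11_form_def v_def)
  have real: "\<eta> (V, z) p v (\<i> *s v) \<in> \<real>" "\<omega> (V, z) p v (\<i> *s v) \<in> \<real>"
    using real_11_form_real[OF \<eta> V p(1)] real_11_form_real[OF \<omega> V p(1)] p by simp_all
  define l where "l = H (z p) v v + H (z p) (\<i> *s v) (\<i> *s v)"
  have dd: "ddc f (W, w) p u (\<i> *s u) = complex_of_real (l / (4 * pi))"
    unfolding l_def by (rule trans[OF tr(1) ddc_eq_hess[where f = f, OF hess(3,1,2,4)]])
  define Z where "Z = (\<Sum>k\<in>UNIV. (cmod (dzeta S (z p) k v))\<^sup>2)"
  define \<Sigma> where "\<Sigma> = (\<Sum>k\<in>S. (cmod (dzeta S (z p) k v))\<^sup>2)"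
  define Q where "Q = l / (4 * pi) + A * Re (\<omega> (V, z) p v (\<i> *s v))"
  have e: "e u = \<eta> (V, z) p v (\<i> *s v) + complex_of_real (B * t) * (complex_of_real (l / (4 * pi)) + of_real A * \<omega> (V, z) p v (\<i> *s v))"
    unfolding e_def pull dd ..
  have "Z \<ge> 0" by (simp add: Z_def sum_nonneg)
  have "Z / (4 * pi * M) \<le> Q"
  proof -
    have "(\<Sigma> / M - M * (norm v)\<^sup>2) / (4 * pi) \<le> l / (4 * pi)"
      unfolding l_def \<Sigma>_def by (intro divide_right_mono lap) simp
    moreover have "(1 / M + M) / (4 * pi) * (norm v)\<^sup>2 \<le> A * Re (\<omega> (V, z) p v (\<i> *s v))"
    proof -
      have "(1 / M + M) / (4 * pi) * (norm v)\<^sup>2 \<le> A * c * (norm v)\<^sup>2"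
        using const(6) by (rule mult_right_mono) simp
      also have "\<dots> \<le> A * Re (\<omega> (V, z) p v (\<i> *s v))"
        using mult_left_mono[OF pos[of v] const(5)] by (simp add: mult.assoc)
      finally show ?thesis .
    qed
    moreover have "Z / (4 * pi * M) \<le> (\<Sigma> + (norm v)\<^sup>2) / (4 * pi * M)"
      using dzeta_sum_le[of S "z p" v] const(1) by (intro divide_right_mono) (auto simp: Z_def \<Sigma>_def)
    \<comment> \<open>Origin of the condition on A c: M |v|^2 cancels the error of the frame
      estimate, and |v|^2 / M stands in for the coordinates outside S.\<close>
    moreover have "(\<Sigma> + (norm v)\<^sup>2) / (4 * pi * M) =
       (\<Sigma> / M - M * (norm v)\<^sup>2) / (4 * pi) + (1 / M + M) / (4 * pi) * (norm v)\<^sup>2"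
      using const(1) by (simp add: field_simps)
    ultimately show ?thesis unfolding Q_def by linarith
  qed
  moreover have "0 \<le> Z / (4 * pi * M)" using \<open>Z \<ge> 0\<close> const(1) by simp
  \<comment> \<open>Both factors grow, \<open>\<tau>\<close> to t and Z / (4 pi M) to Q. As Q is
    nonnegative, enlarging B or t cannot spoil the estimate.\<close>
  ultimately have "B * \<tau> * (Z / (4 * pi * M)) \<le> B * t * Q"
  proof (intro mult_mono)
    show B: "0 \<le> B" using const(1,2,7) by (smt (verit) mult_nonneg_nonneg pi_ge_zero zero_le_power2)
    show "0 \<le> B * t" using B const(3,4) by simp
  qed (use const in auto)
  moreover have "2 * (real CARD('n + 'n))\<^sup>2 * E * \<tau> * Z \<le> B * \<tau> * (Z / (4 * pi * M))"
  proof -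
    have "2 * (real CARD('n + 'n))\<^sup>2 * E * (4 * pi * M) * (\<tau> * (Z / (4 * pi * M))) \<le> B * (\<tau> * (Z / (4 * pi * M)))"
      using \<open>Z \<ge> 0\<close> const by (intro mult_right_mono) auto
    moreover have "4 * pi * M \<noteq> 0" using const(1) by simp
    ultimately show ?thesis by (simp add: mult_ac)
  qed
  \<comment> \<open>There is one term for each pair of covectors of the coframe, and each wedge is
    at most 2 Z.\<close>
  moreover have "cmod (\<eta> (V, z) p v (\<i> *s v)) \<le> 2 * (real CARD('n + 'n))\<^sup>2 * E * \<tau> * Z"
  proof -
    have "\<eta> (V, z) p v (\<i> *s v) = (\<Sum>a\<in>UNIV. \<Sum>b\<in>UNIV. g a b p * wedge (coframe S (z p) a) (coframe S (z p) b) v (\<i> *s v))"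
      using coeff p by (auto simp: coefficients_def)
    also have "cmod \<dots> \<le> (\<Sum>a\<in>(UNIV::('n + 'n) set). \<Sum>b\<in>(UNIV::('n + 'n) set). E * \<tau> * (2 * Z))"
    proof (intro order_trans[OF norm_sum] sum_mono)
      fix a b
      show "cmod (g a b p * wedge (coframe S (z p) a) (coframe S (z p) b) v (\<i> *s v)) \<le> E * \<tau> * (2 * Z)"
        unfolding norm_mult Z_def using const by (intro mult_mono g coframe_bounds) auto
    qed
    finally show ?thesis by (simp add: power2_eq_square mult_ac)
  qed
  moreover have "- cmod (\<eta> (V, z) p v (\<i> *s v)) \<le> Re (\<eta> (V, z) p v (\<i> *s v))"
    using abs_Re_le_cmod[of "\<eta> (V, z) p v (\<i> *s v)"] by linarith
  moreover have "Re (e u) = Re (\<eta> (V, z) p v (\<i> *s v)) + B * t * Q"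
    unfolding e Q_def by simp
  moreover have "e u \<in> \<real>"
    unfolding e using real by (intro Reals_add Reals_mult Reals_of_real)
  ultimately show ?thesis by linarith
qed

section \<open>Powers of Theta and log-log bounds\<close>

lemma Theta_mono:
  assumes "\<And>k. k \<in> {1..m} \<Longrightarrow> ln (ln (inverse (nsq k p))) \<ge> 1" "N \<le> N'"
  shows "Theta m nsq N p \<le> Theta m nsq N' p"
  unfolding Theta_def by (intro sum_mono power_increasing assms)

lemma Theta_nonneg:
  assumes "\<And>k. k \<in> {1..m} \<Longrightarrow> ln (ln (inverse (nsq k p))) \<ge> 1"
  shows "0 \<le> Theta m nsq N p"
  unfolding Theta_def by (intro sum_nonneg zero_le_power order_trans[OF zero_le_one] assms)

text \<open>The sum is at most m times its largest term, whose q-th power is one of the nonnegative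
  terms of Theta_q.\<close>

lemma Theta_1_power:
  assumes "m \<ge> 1" "\<And>k. k \<in> {1..m} \<Longrightarrow> ln (ln (inverse (nsq k p))) \<ge> 1"
  shows "Theta m nsq 1 p ^ q \<le> real m ^ q * Theta m nsq q p"
proof -
  define t where "t = (\<lambda>k. ln (ln (inverse (nsq k p))))"
  have "finite (t ` {1..m})" "t ` {1..m} \<noteq> {}" using assms(1) by auto
  from Max_in[OF this] obtain k where k: "k \<in> {1..m}" "t k = Max (t ` {1..m})" by auto
  have le: "t i \<le> t k" if "i \<in> {1..m}" for i unfolding k(2) using that by simp
  have t1: "t i \<ge> 1" if "i \<in> {1..m}" for i using assms(2)[OF that] by (simp add: t_def)
  have "Theta m nsq 1 p \<le> real m * t k"
    using sum_mono[of "{1..m}" t "\<lambda>_. t k", OF le] by (simp add: Theta_def t_def)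
  then have "Theta m nsq 1 p ^ q \<le> (real m * t k) ^ q"
    by (rule power_mono[OF _ Theta_nonneg[of m nsq p, OF assms(2)]])
  also have "\<dots> = real m ^ q * t k ^ q" by (rule power_mult_distrib)
  also have "t k ^ q \<le> (\<Sum>i\<in>{1..m}. t i ^ q)"
    using t1 by (intro member_le_sum k(1)) (auto intro!: zero_le_power order_trans[OF zero_le_one])
  finally show ?thesis by (simp add: Theta_def t_def mult_left_mono)
qed

text \<open>From l <= M L and ln L >= 1 follows ln l <= ln M + ln L <= (ln M + 1) ln L, and ln L is
  one term of Theta_1. The product over S thus becomes a power of Theta_1 with exponent N card S,
  which the preceding lemma turns into Theta with that exponent.\<close>

lemma loglog_le_Theta:
  fixes z :: "complex^'n::finite"
  assumes m: "m \<ge> 1" and t1: "\<And>k. k \<in> {1..m} \<Longrightarrow> ln (ln (inverse (nsq k p))) \<ge> 1"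
    and z: "\<And>k. k \<in> S \<Longrightarrow> z $ k \<noteq> 0 \<and> cmod (z $ k) < 1 / exp 1"
    and M: "M \<ge> 1"
      "\<And>k. k \<in> S \<Longrightarrow> \<exists>k'\<in>{1..m}. ln (inverse (cmod (z $ k))) \<le> M * ln (inverse (nsq k' p))"
  shows "C * (\<Prod>k\<in>S. ln (ln (inverse (cmod (z $ k)))) ^ N)
     \<le> \<bar>C\<bar> * ((ln M + 1) * real m) ^ (N * card S) * Theta m nsq (N * card S) p"
proof -
  define Q where "Q = (ln M + 1) * Theta m nsq 1 p"
  have lM: "ln M \<ge> 0" using M(1) by simp
  have k1: "0 \<le> ln (ln (inverse (cmod (z $ k)))) \<and> ln (ln (inverse (cmod (z $ k)))) \<le> Q" if k: "k \<in> S" for k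
  proof -
    define l where "l = ln (inverse (cmod (z $ k)))"
    have "exp 1 < inverse (cmod (z $ k))"
      using z[OF k] by (simp add: field_simps)
    then have l: "l > 1" unfolding l_def using z[OF k]
      by (metis exp_gt_zero ln_exp ln_less_cancel_iff order_less_trans)
    obtain k' where k': "k' \<in> {1..m}" "l \<le> M * ln (inverse (nsq k' p))"
      using M(2)[OF k] by (auto simp: l_def)
    define L where "L = ln (inverse (nsq k' p))"
    have "0 < M * L" using k'(2) l by (simp add: L_def)
    then have L: "0 < L" using M(1) by (simp add: zero_less_mult_iff)
    have t: "ln L \<ge> 1" using t1[OF k'(1)] by (simp add: L_def)
    have "ln l \<le> ln (M * L)" using k'(2) l by (simp add: L_def)
    also have "\<dots> = ln M + ln L" using M(1) L by (simp add: ln_mult)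
    also have "\<dots> \<le> (ln M + 1) * ln L"
      using mult_left_mono[OF t lM] by (simp add: algebra_simps)
    also have "ln L \<le> Theta m nsq 1 p"
    proof -
      have "ln L ^ 1 \<le> Theta m nsq 1 p"
        unfolding Theta_def L_def using t1
        by (intro member_le_sum[of k' "{1..m}" "\<lambda>k. ln (ln (inverse (nsq k p))) ^ 1"] k'(1))
           (auto intro: order_trans[OF zero_le_one])
      then show ?thesis by simp
    qed
    finally have "ln l \<le> Q" using lM by (simp add: Q_def mult_left_mono)
    then show ?thesis using l by (simp add: l_def)
  qed
  have "(\<Prod>k\<in>S. ln (ln (inverse (cmod (z $ k)))) ^ N) \<le> (\<Prod>k\<in>S. Q ^ N)"
    using k1 by (intro prod_mono) (auto intro: power_mono)
  also have "\<dots> = Q ^ (N * card S)" by (simp add: power_mult)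
  also have "\<dots> = (ln M + 1) ^ (N * card S) * Theta m nsq 1 p ^ (N * card S)"
    by (simp add: Q_def power_mult_distrib)
  also have "\<dots> \<le> (ln M + 1) ^ (N * card S) * (real m ^ (N * card S) * Theta m nsq (N * card S) p)"
    using lM by (intro mult_left_mono Theta_1_power m t1) auto
  finally have *: "(\<Prod>k\<in>S. ln (ln (inverse (cmod (z $ k)))) ^ N)
     \<le> ((ln M + 1) * real m) ^ (N * card S) * Theta m nsq (N * card S) p"
    by (simp add: power_mult_distrib mult.assoc)
  \<comment> \<open>The growth condition does not fix the sign of C.\<close>
  have "C * (\<Prod>k\<in>S. ln (ln (inverse (cmod (z $ k)))) ^ N) \<le> \<bar>C\<bar> * (\<Prod>k\<in>S. ln (ln (inverse (cmod (z $ k)))) ^ N)"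
    using k1 by (intro mult_right_mono prod_nonneg) auto
  also have "\<dots> \<le> \<bar>C\<bar> * (((ln M + 1) * real m) ^ (N * card S) * Theta m nsq (N * card S) p)"
    by (rule mult_left_mono[OF *]) simp
  finally show ?thesis by (simp add: mult.assoc)
qed

text \<open>The sum of the local thresholds over a finite subcover exceeds each of them.\<close>

lemma compact_uniform_nat:
  fixes Q :: "nat \<Rightarrow> 'x::topological_space \<Rightarrow> bool"
  assumes comp: "compact (UNIV :: 'x set)"
    and loc: "\<And>p. \<exists>W n. open W \<and> p \<in> W \<and> (\<forall>q\<in>W. Q n q)"
    and mono: "\<And>n n' q. Q n q \<Longrightarrow> n \<le> n' \<Longrightarrow> Q n' q"
  shows "\<exists>n. \<forall>q. Q n q"
proof -
  obtain W n where W: "\<And>p. open (W p)" "\<And>p. p \<in> W p" "\<And>p q. q \<in> W p \<Longrightarrow> Q (n p) q"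
    using loc by metis
  obtain P where P: "finite P" "UNIV \<subseteq> (\<Union>p\<in>P. W p)"
  proof (rule compactE_image[OF comp, of UNIV W])
    show "UNIV \<subseteq> (\<Union>p\<in>UNIV. W p)" using W(2) by blast
  qed (use W(1) in auto)
  have "Q (\<Sum>p\<in>P. n p) q" for q
  proof -
    obtain p where p: "p \<in> P" "q \<in> W p" using P(2) by blast
    from mono[OF W(3)[OF p(2)]] show ?thesis
      using member_le_sum[OF p(1), of n] P(1) by simp
  qed
  then show ?thesis by blast
qed

text \<open>With m = 0 every Theta_N would be an empty sum and the claim would read
  \<open>\<eta>\<close> >= 0; the hypothesis \<open>m \<ge> 1\<close> excludes this.\<close>

theorem theorem4p2:
  fixes atl :: "('x::t2_space, 'n::finite) chart set"
    and m :: nat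
    and D :: "nat \<Rightarrow> 'x set"
    and s :: "nat \<Rightarrow> 'x set \<times> ('x \<Rightarrow> complex) \<Rightarrow> 'x \<Rightarrow> complex"
    and h :: "nat \<Rightarrow> 'x set \<times> ('x \<Rightarrow> complex) \<Rightarrow> 'x \<Rightarrow> real"
    and \<omega> \<eta> :: "('x, 'n) form2"
  defines "DD \<equiv> (\<Union>k\<in>{1..m}. D k)"
    and "\<Theta> \<equiv> Theta m (\<lambda>k. norm_sq atl (D k) (h k) (s k))"
  assumes "compact (UNIV :: 'x set)"
    and "complex_structure atl"
    and "m \<ge> 1"
    and "snc_divisor atl m D"
    and "\<And>k. k \<in> {1..m} \<Longrightarrow> global_section atl (D k) (s k)"
    and "\<And>k. k \<in> {1..m} \<Longrightarrow> div_eq atl (D k) (s k)"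
    and "\<And>k. k \<in> {1..m} \<Longrightarrow> hermitian_metric atl (D k) (h k)"
    and "\<And>k p. k \<in> {1..m} \<Longrightarrow> norm_sq atl (D k) (h k) (s k) p \<le> exp (- exp 1)"
    and "real_11_form atl UNIV \<omega>"
    and "smooth_form atl UNIV \<omega>"
    and "pos_form atl UNIV \<omega>"
    and "real_11_form atl (- DD) \<eta>"
    and "loglog_growth atl DD \<eta>"
  shows "(\<exists>(A::real) (B::real) (N::nat). A > 0 \<and> B > 0 \<and>
            nonneg_form atl (- DD)
              (\<lambda>c p u v. \<eta> c p u v + of_real (B * \<Theta> N p) *
                 (ddc (\<lambda>q. - \<Theta> 1 q) c p u v + of_real A * \<omega> c p u v)))
       \<and> (poincare_growth atl DD \<eta> \<longrightarrow>
          (\<exists>(A::real) (B::real). A > 0 \<and> B > 0 \<and>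
            nonneg_form atl (- DD)
              (\<lambda>c p u v. \<eta> c p u v + of_real (B * \<Theta> 0 p) *
                 (ddc (\<lambda>q. - \<Theta> 1 q) c p u v + of_real A * \<omega> c p u v))))"
proof -
  note comp = assms(3) and cs = assms(4) and m1 = assms(5) and snc = assms(6)
    and small = assms(10) and om = assms(11-13) and et = assms(14)
  define nsq where "nsq k = norm_sq atl (D k) (h k) (s k)" for k
  have \<Theta>: "\<Theta> = Theta m nsq" by (simp add: \<Theta>_def nsq_def[abs_def])
  have om2: "two_form atl UNIV \<omega>" using om(1) by (simp add: real_11_form_def)
  note frame = local_frame[OF comp cs snc assms(7-10) om2 om(2,3), folded DD_def nsq_def]
  \<comment> \<open>Positivity of the norm off the divisor, without which the logarithms carry no
    information, is read off from a frame around p.\<close>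
  have t1: "ln (ln (inverse (nsq k p))) \<ge> 1" if "k \<in> {1..m}" "p \<notin> DD" for k p
  proof -
    have "nsq k p > 0"
    proof (rule frame[of p])
      fix V W
      assume "p \<in> W" "closure W \<subseteq> V" and pos: "\<And>k q. k \<in> {1..m} \<Longrightarrow> q \<in> V - DD \<Longrightarrow> nsq k q > 0"
      then have "p \<in> V" using closure_subset by blast
      then show "nsq k p > 0" using pos that by blast
    qed
    then show ?thesis using ln_ln_inverse_ge_1(2) small[OF that(1)] by (simp add: nsq_def)
  qed
  \<comment> \<open>The desired inequality at one point, in all charts and with a real number t for
    Theta_N, so that both parts of the theorem are instances.\<close>
  define ok where "ok = (\<lambda>A B t p. \<forall>W w. (W, w) \<in> atl \<longrightarrow> p \<in> W \<longrightarrow> (\<forall>u. \<eta> (W, w) p u (\<i> *s u) +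
    of_real (B * t) * (ddc (\<lambda>q. - \<Theta> 1 q) (W, w) p u (\<i> *s u) + of_real A * \<omega> (W, w) p u (\<i> *s u)) \<in> \<real> \<and>
    0 \<le> Re (\<eta> (W, w) p u (\<i> *s u) +
    of_real (B * t) * (ddc (\<lambda>q. - \<Theta> 1 q) (W, w) p u (\<i> *s u) + of_real A * \<omega> (W, w) p u (\<i> *s u)))))"
  have nonneg: "nonneg_form atl (- DD) (\<lambda>c p u v. \<eta> c p u v + of_real (B * \<Theta> N p) *
                 (ddc (\<lambda>q. - \<Theta> 1 q) c p u v + of_real A * \<omega> c p u v))"
    if "\<And>p. p \<notin> DD \<Longrightarrow> ok A B (\<Theta> N p) p" for A B :: real and N
    unfolding nonneg_form_def
  proof (intro ballI allI)
    fix c p and u :: "complex^'n" assume c: "c \<in> atl" "p \<in> fst c \<inter> - DD"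
    obtain W w where W: "c = (W, w)" by (cases c)
    have "ok A B (\<Theta> N p) p" using that c(2) by blast
    from this[unfolded ok_def, rule_format, OF c(1)[unfolded W]] c(2)
    show "\<eta> c p u (\<i> *s u) + of_real (B * \<Theta> N p) *
        (ddc (\<lambda>q. - \<Theta> 1 q) c p u (\<i> *s u) + of_real A * \<omega> c p u (\<i> *s u)) \<in> \<real> \<and>
      0 \<le> Re (\<eta> c p u (\<i> *s u) + of_real (B * \<Theta> N p) *
        (ddc (\<lambda>q. - \<Theta> 1 q) c p u (\<i> *s u) + of_real A * \<omega> c p u (\<i> *s u)))"
      unfolding W by simp
  qed
  \<comment> \<open>A0 and B0 are fixed before the coefficients g and their bound E
    \<open>\<tau>\<close>, so the same frame serves both growth conditions: \<open>\<tau>\<close>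
    will be a Theta in the log-log case and 1 in the Poincare case.\<close>
  have key: "\<exists>V z S W M A0 B0. adapted_chart atl DD (V, z) S \<and> p0 \<in> W \<and> open W \<and> compact (closure W) \<and>
      closure W \<subseteq> V \<and> M \<ge> 1 \<and>
      (\<forall>k\<in>S. \<exists>k'\<in>{1..m}. \<forall>p\<in>W - DD. ln (inverse (cmod (z p $ k))) \<le> M * ln (inverse (nsq k' p))) \<and>
      B0 \<ge> 0 \<and>
      (\<forall>g E \<tau> t A B p. coefficients atl DD \<eta> (V, z) S g \<and> p \<in> W - DD \<and> (\<forall>a b. cmod (g a b p) \<le> E * \<tau>) \<and>
         0 \<le> E \<and> 0 \<le> \<tau> \<and> \<tau> \<le> t \<and> A \<ge> A0 \<and> B \<ge> B0 * E \<longrightarrow> ok A B t p)" for p0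
  proof (rule frame[of p0])
    fix V z S W M c T F G H
    assume ad: "adapted_chart atl DD (V, z) S" and W: "p0 \<in> W" "open W"
      "compact (closure W)" "closure W \<subseteq> V" and M: "M \<ge> 1" and c: "c > 0"
      and T: "open T" "z ` (V - DD) \<subseteq> T" and hess: "hess_on T F G H"
      and F: "\<And>x. x \<in> T \<Longrightarrow> - Theta m nsq 1 (inv_into V z x) = F x"
      and lap: "\<And>p u. p \<in> W - DD \<Longrightarrow> H (z p) u u + H (z p) (\<i> *s u) (\<i> *s u) \<ge>
        (\<Sum>k\<in>S. (cmod (dzeta S (z p) k u))\<^sup>2) / M - M * (norm u)\<^sup>2"
      and pos: "\<And>p u. p \<in> W \<Longrightarrow> Re (\<omega> (V, z) p u (\<i> *s u)) \<ge> c * (norm u)\<^sup>2"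
      and Mle: "\<And>k. k \<in> S \<Longrightarrow> \<exists>k'\<in>{1..m}. \<forall>p\<in>W - DD. ln (inverse (cmod (z p $ k))) \<le> M * ln (inverse (nsq k' p))"
    have V: "(V, z) \<in> atl" using ad by (simp add: adapted_chart_def)
    have WV: "W \<subseteq> V" using W(4) closure_subset by blast
    \<comment> \<open>A0 and B0 solve the two conditions on constants in
      \<open>frame_pointwise\<close>, the one for B up to its factor E.\<close>
    define A0 where "A0 = (1 / M + M) / (4 * pi) / c"
    define B0 where "B0 = 2 * (real CARD('n + 'n))\<^sup>2 * (4 * pi * M)"
    have A0: "A0 \<ge> 0" using M c by (simp add: A0_def)
    have B0: "B0 \<ge> 0" using M by (simp add: B0_def)
    have okI: "ok A B t p" if g: "coefficients atl DD \<eta> (V, z) S g" "p \<in> W - DD" "\<And>a b. cmod (g a b p) \<le> E * \<tau>"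
        "0 \<le> E" "0 \<le> \<tau>" "\<tau> \<le> t" "A \<ge> A0" "B \<ge> B0 * E" for g E \<tau> t A B p
    proof -
      have p: "p \<in> V" "p \<notin> DD" "p \<in> W" "z p \<in> T" using g(2) WV T(2) by auto
      have 1: "A * c \<ge> (1 / M + M) / (4 * pi)"
        using g(7) c unfolding A0_def by (simp add: pos_divide_le_eq mult_ac)
      have 2: "B \<ge> 2 * (real CARD('n + 'n))\<^sup>2 * E * (4 * pi * M)"
        using g(8) unfolding B0_def by (simp add: mult_ac)
      have 3: "A \<ge> 0" using A0 g(7) by simp
      show ?thesis
        unfolding ok_def \<Theta>
        by (intro allI impI, rule frame_pointwise[where f = "\<lambda>q. - Theta m nsq 1 q", OF cs V p(1,2) et om(1)
            T(1) p(4) hess F lap[OF g(2)] pos[OF p(3)] g(1,3) M g(4-6) 3 1 2])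
    qed
    have "\<forall>k\<in>S. \<exists>k'\<in>{1..m}. \<forall>p\<in>W - DD. ln (inverse (cmod (z p $ k))) \<le> M * ln (inverse (nsq k' p))"
      using Mle by (rule ballI)
    moreover have "\<forall>g E \<tau> t A B p. coefficients atl DD \<eta> (V, z) S g \<and> p \<in> W - DD \<and> (\<forall>a b. cmod (g a b p) \<le> E * \<tau>) \<and>
         0 \<le> E \<and> 0 \<le> \<tau> \<and> \<tau> \<le> t \<and> A \<ge> A0 \<and> B \<ge> B0 * E \<longrightarrow> ok A B t p"
      by (intro allI impI, elim conjE, rule okI) auto
    ultimately show ?thesis using ad W M B0
      by (intro exI[of _ V] exI[of _ z] exI[of _ S] exI[of _ W] exI[of _ M] exI[of _ A0] exI[of _ B0] conjI)
  qed
  have \<Theta>0: "\<Theta> N p \<ge> 0" if "p \<notin> DD" for N p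
    unfolding \<Theta> by (rule Theta_nonneg, rule t1[OF _ that])
  have \<Theta>mono: "\<Theta> N p \<le> \<Theta> N' p" if "p \<notin> DD" "N \<le> N'" for N N' p
    unfolding \<Theta> by (rule Theta_mono[OF _ that(2)], rule t1[OF _ that(1)])
  \<comment> \<open>One n bounds A, B and N from below at once; the quantification over all larger
    values makes the property monotone in n, as the compactness lemma demands.\<close>
  have "\<exists>n::nat. \<forall>p. p \<notin> DD \<longrightarrow> (\<forall>A B N. A \<ge> real n \<and> B \<ge> real n \<and> N \<ge> n \<longrightarrow> ok A B (\<Theta> N p) p)"
  proof (rule compact_uniform_nat[OF comp])
    fix p0
    obtain V z S W M A0 B0 where ad: "adapted_chart atl DD (V, z) S" and W: "p0 \<in> W" "open W"
      "compact (closure W)" "closure W \<subseteq> V" and M: "M \<ge> 1"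
      and Mle: "\<And>k. k \<in> S \<Longrightarrow> \<exists>k'\<in>{1..m}. \<forall>p\<in>W - DD. ln (inverse (cmod (z p $ k))) \<le> M * ln (inverse (nsq k' p))"
      and B0: "B0 \<ge> 0"
      and okI: "\<And>g E \<tau> t A B p. coefficients atl DD \<eta> (V, z) S g \<Longrightarrow> p \<in> W - DD \<Longrightarrow>
         (\<And>a b. cmod (g a b p) \<le> E * \<tau>) \<Longrightarrow> 0 \<le> E \<Longrightarrow> 0 \<le> \<tau> \<Longrightarrow> \<tau> \<le> t \<Longrightarrow> A \<ge> A0 \<Longrightarrow> B \<ge> B0 * E \<Longrightarrow> ok A B t p"
      using key[of p0] by metis
    have WV: "W \<subseteq> V" using W(4) closure_subset by blast
    obtain g where g: "coefficients atl DD \<eta> (V, z) S g"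
      "\<And>a b V'. compact (closure V') \<and> closure V' \<subseteq> V \<Longrightarrow> (\<exists>(C::real) (N::nat). \<forall>p\<in>V' - DD.
              cmod (g a b p) \<le> C * (\<Prod>k\<in>S. (ln (ln (inverse (cmod (z p $ k))))) ^ N))"
      using assms(15) ad unfolding loglog_growth_def by metis
    obtain C N where CN: "\<And>a b p. p \<in> W - DD \<Longrightarrow>
        cmod (g a b p) \<le> C a b * (\<Prod>k\<in>S. (ln (ln (inverse (cmod (z p $ k))))) ^ N a b)"
      using g(2)[OF conjI[OF W(3,4)]] by metis
    \<comment> \<open>Exponents and constants from \<open>loglog_le_Theta\<close>, one for each pair
      (a, b). Their finite sums E0 and q0 serve as common upper bounds.\<close>
    define q where "q = (\<lambda>a b. N a b * card S)"
    define E where "E = (\<lambda>a b. \<bar>C a b\<bar> * ((ln M + 1) * real m) ^ q a b)"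
    have Enn: "E a b \<ge> 0" for a b using M by (simp add: E_def)
    define E0 where "E0 = (\<Sum>a\<in>UNIV. \<Sum>b\<in>UNIV. E a b)"
    define q0 where "q0 = (\<Sum>a\<in>UNIV. \<Sum>b\<in>UNIV. q a b)"
    have E0: "E a b \<le> E0" for a b
    proof -
      have "E a b \<le> (\<Sum>b\<in>UNIV. E a b)" by (rule member_le_sum) (auto simp: Enn)
      also have "\<dots> \<le> E0" unfolding E0_def by (rule member_le_sum) (auto intro: sum_nonneg simp: Enn)
      finally show ?thesis .
    qed
    have E0nn: "0 \<le> E0" unfolding E0_def by (intro sum_nonneg Enn)
    have q0: "q a b \<le> q0" for a b
    proof -
      have "q a b \<le> (\<Sum>b\<in>UNIV. q a b)" by (rule member_le_sum) auto
      also have "\<dots> \<le> q0" unfolding q0_def by (rule member_le_sum) auto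
      finally show ?thesis .
    qed
    have gb: "cmod (g a b p) \<le> E0 * \<Theta> q0 p" if p: "p \<in> W - DD" for a b p
    proof -
      have pV: "p \<in> V" "p \<notin> DD" using p WV by auto
      have z: "z p $ k \<noteq> 0 \<and> cmod (z p $ k) < 1 / exp 1" if "k \<in> S" for k
        using ad pV that unfolding adapted_chart_def by (auto simp: prod_zero_iff)
      have "cmod (g a b p) \<le> E a b * \<Theta> (q a b) p"
        unfolding E_def q_def \<Theta>
        using CN[OF p] loglog_le_Theta[of m nsq p S "z p" M "C a b" "N a b", OF m1 t1[OF _ pV(2)] z M] Mle p
        by (meson order_trans)
      also have "\<dots> \<le> E0 * \<Theta> q0 p"
        using Enn E0 E0nn \<Theta>0[OF pV(2)] \<Theta>mono[OF pV(2) q0] by (intro mult_mono) auto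
      finally show ?thesis .
    qed
    obtain n :: nat where n: "real n \<ge> max A0 (max (B0 * E0) (real q0))" using real_arch_simple by blast
    have "ok A B (\<Theta> N p) p" if p: "p \<in> W" "p \<notin> DD" and AB: "A \<ge> real n" "B \<ge> real n" "N \<ge> n" for p A B N
    proof (rule okI[OF g(1) _ gb E0nn \<Theta>0[OF p(2)]])
      have "q0 \<le> N" using n AB(3) by simp
      then show "\<Theta> q0 p \<le> \<Theta> N p" by (rule \<Theta>mono[OF p(2)])
    qed (use p n AB in auto)
    then show "\<exists>W n. open W \<and> p0 \<in> W \<and> (\<forall>p\<in>W. p \<notin> DD \<longrightarrow>
        (\<forall>A B N. A \<ge> real n \<and> B \<ge> real n \<and> N \<ge> n \<longrightarrow> ok A B (\<Theta> N p) p))"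
      using W by blast
  next
    fix n n' :: nat and p
    assume *: "p \<notin> DD \<longrightarrow> (\<forall>A B N. A \<ge> real n \<and> B \<ge> real n \<and> N \<ge> n \<longrightarrow> ok A B (\<Theta> N p) p)" and "n \<le> n'"
    then have "real n \<le> real n'" by simp
    with * \<open>n \<le> n'\<close> show "p \<notin> DD \<longrightarrow> (\<forall>A B N. A \<ge> real n' \<and> B \<ge> real n' \<and> N \<ge> n' \<longrightarrow> ok A B (\<Theta> N p) p)"
      by (meson order_trans)
  qed
  then obtain n :: nat where n: "\<And>p A B N. p \<notin> DD \<Longrightarrow> A \<ge> real n \<Longrightarrow> B \<ge> real n \<Longrightarrow> N \<ge> n \<Longrightarrow> ok A B (\<Theta> N p) p"
    by blast
  have part1: "nonneg_form atl (- DD) (\<lambda>c p u v. \<eta> c p u v + of_real ((real n + 1) * \<Theta> n p) *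
                 (ddc (\<lambda>q. - \<Theta> 1 q) c p u v + of_real (real n + 1) * \<omega> c p u v))"
    by (rule nonneg[OF n]) auto
  have part2: "\<exists>n::nat. \<forall>p. p \<notin> DD \<longrightarrow> (\<forall>A B. A \<ge> real n \<and> B \<ge> real n \<longrightarrow> ok A B (\<Theta> 0 p) p)"
    if poin: "poincare_growth atl DD \<eta>"
  proof (rule compact_uniform_nat[OF comp])
    fix p0
    obtain V z S W M A0 B0 where ad: "adapted_chart atl DD (V, z) S" and W: "p0 \<in> W" "open W"
      "closure W \<subseteq> V" and B0: "B0 \<ge> 0"
      and okI: "\<And>g E \<tau> t A B p. coefficients atl DD \<eta> (V, z) S g \<Longrightarrow> p \<in> W - DD \<Longrightarrow>
         (\<And>a b. cmod (g a b p) \<le> E * \<tau>) \<Longrightarrow> 0 \<le> E \<Longrightarrow> 0 \<le> \<tau> \<Longrightarrow> \<tau> \<le> t \<Longrightarrow> A \<ge> A0 \<Longrightarrow> B \<ge> B0 * E \<Longrightarrow> ok A B t p"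
      using key[of p0] by metis
    have WV: "W \<subseteq> V" using W(3) closure_subset by blast
    obtain g where g: "coefficients atl DD \<eta> (V, z) S g"
      "\<And>a b p. p \<in> V \<Longrightarrow> \<exists>W. open W \<and> p \<in> W \<and> (\<exists>C::real. \<forall>q\<in>(W \<inter> V) - DD. cmod (g a b q) \<le> C)"
      using poin ad unfolding poincare_growth_def by metis
    have "p0 \<in> V" using W WV by blast
    then obtain U C where U: "\<And>a b. open (U a b)" "\<And>a b. p0 \<in> U a b"
      and C: "\<And>a b q. q \<in> (U a b \<inter> V) - DD \<Longrightarrow> cmod (g a b q) \<le> C a b"
      using g(2) by metis
    \<comment> \<open>The neighbourhoods depend on the coefficient; there are finitely many, so
      their intersection is still open.\<close>
    define W' where "W' = W \<inter> (\<Inter>a\<in>UNIV. \<Inter>b\<in>UNIV. U a b)"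
    have W': "open W'" "p0 \<in> W'" "W' \<subseteq> W" using W U unfolding W'_def by (auto intro!: open_Int open_INT)
    define E0 where "E0 = (\<Sum>a\<in>UNIV. \<Sum>b\<in>UNIV. \<bar>C a b\<bar>)"
    have E0nn: "0 \<le> E0" unfolding E0_def by (intro sum_nonneg) auto
    have gb: "cmod (g a b p) \<le> E0 * 1" if p: "p \<in> W' - DD" for a b p
    proof -
      have "cmod (g a b p) \<le> C a b" using p WV by (intro C) (auto simp: W'_def)
      also have "\<dots> \<le> \<bar>C a b\<bar>" by simp
      also have "\<dots> \<le> (\<Sum>b\<in>UNIV. \<bar>C a b\<bar>)" by (rule member_le_sum) auto
      also have "\<dots> \<le> E0" unfolding E0_def by (rule member_le_sum) (auto intro: sum_nonneg)
      finally show ?thesis by simp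
    qed
    \<comment> \<open>Each zeroth power is 1, so Theta_0 = m, which dominates \<open>\<tau>\<close>
      = 1.\<close>
    have "\<Theta> 0 p \<ge> 1" for p using m1 by (simp add: \<Theta> Theta_def)
    moreover obtain n :: nat where n: "real n \<ge> max A0 (B0 * E0)" using real_arch_simple by blast
    ultimately have "ok A B (\<Theta> 0 p) p" if "p \<in> W'" "p \<notin> DD" "A \<ge> real n" "B \<ge> real n" for p A B
      using that W'(3) by (intro okI[OF g(1) _ gb E0nn]) auto
    then show "\<exists>W n. open W \<and> p0 \<in> W \<and> (\<forall>p\<in>W. p \<notin> DD \<longrightarrow>
        (\<forall>A B. A \<ge> real n \<and> B \<ge> real n \<longrightarrow> ok A B (\<Theta> 0 p) p))"
      using W' by blast
  next
    fix n n' :: nat and p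
    assume *: "p \<notin> DD \<longrightarrow> (\<forall>A B. A \<ge> real n \<and> B \<ge> real n \<longrightarrow> ok A B (\<Theta> 0 p) p)" and "n \<le> n'"
    then have "real n \<le> real n'" by simp
    with * show "p \<notin> DD \<longrightarrow> (\<forall>A B. A \<ge> real n' \<and> B \<ge> real n' \<longrightarrow> ok A B (\<Theta> 0 p) p)"
      by (meson order_trans)
  qed
  show ?thesis
  proof (intro conjI impI)
    show "\<exists>A B N. A > 0 \<and> B > 0 \<and> nonneg_form atl (- DD) (\<lambda>c p u v. \<eta> c p u v + of_real (B * \<Theta> N p) *
                 (ddc (\<lambda>q. - \<Theta> 1 q) c p u v + of_real A * \<omega> c p u v))"
      using part1 by (intro exI[of _ "real n + 1"] exI[of _ n] conjI) auto
    assume "poincare_growth atl DD \<eta>"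
    then obtain n :: nat where n: "\<And>p A B. p \<notin> DD \<Longrightarrow> A \<ge> real n \<Longrightarrow> B \<ge> real n \<Longrightarrow> ok A B (\<Theta> 0 p) p"
      using part2 by blast
    have "nonneg_form atl (- DD) (\<lambda>c p u v. \<eta> c p u v + of_real ((real n + 1) * \<Theta> 0 p) *
                 (ddc (\<lambda>q. - \<Theta> 1 q) c p u v + of_real (real n + 1) * \<omega> c p u v))"
      by (rule nonneg[OF n]) auto
    then show "\<exists>A B. A > 0 \<and> B > 0 \<and> nonneg_form atl (- DD) (\<lambda>c p u v. \<eta> c p u v + of_real (B * \<Theta> 0 p) *
                 (ddc (\<lambda>q. - \<Theta> 1 q) c p u v + of_real A * \<omega> c p u v))"
      by (intro exI[of _ "real n + 1"] conjI) auto
  qed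
qed

end
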